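(* Let $p$ be a prime, $\nu\ge 1$ an integer, $G$ a free abelian group, and let $\{\overline{b_\alpha}:\alpha\in\mathfrak{I}\}$ be a (free) basis of $G/p^\nu G$ as a $\mathbb{Z}/p^\nu\mathbb{Z}$-module. Then there exist a family of integers $\{u_\alpha:\alpha\in\mathfrak{I}\}$, each relatively prime to $p$, and a free basis $\{y_\alpha:\alpha\in\mathfrak{I}\}$ of $G$, such that $\overline{y_\alpha}=u_\alpha\,\overline{b_\alpha}$ in $G/p^\nu G$ for all $\alpha\in\mathfrak{I}$.
   Context: For $x\in G$, $\overline{x}$ denotes the image of $x$ under the natural map $G\to G/p^\nu G$. The index set $\mathfrak{I}$ may have any cardinality. *)

theory Defs
  imports
    "HOL-Algebra.Free_Abelian_Groups"
    "HOL-Algebra.IntRing"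
    "HOL-Number_Theory.Residues"
begin

text \<open>Abelian groups are written multiplicatively, as everywhere in HOL-Algebra: the multiple
  \<open>k x\<close> is \<open>x [^] k\<close>, and \<open>n G\<close> is the subgroup of \<open>n\<close>-th powers.\<close>

definition multiples :: "('a, 'm) monoid_scheme \<Rightarrow> nat \<Rightarrow> 'a set" where
  "multiples G n = (\<lambda>x. x [^]\<^bsub>G\<^esub> n) ` carrier G"

text \<open>The abelian group \<open>G\<close> with its action of the integers.  The ring multiplication and unit
  of the \<^type>\<open>module_scheme\<close> record play no role in \<^locale>\<open>module\<close> and are left unspecified.
  If \<open>n G = 0\<close>, the same record, with scalars restricted to the representatives
  \<open>0, \<dots>, n - 1\<close>, is the module over \<open>\<int>/n\<int>\<close>.\<close>

definition int_module :: "('a, 'm) monoid_scheme \<Rightarrow> (int, 'a) module" where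
  "int_module G = \<lparr>carrier = carrier G, monoid.mult = undefined, one = undefined,
     zero = \<one>\<^bsub>G\<^esub>, add = (\<otimes>\<^bsub>G\<^esub>), smult = (\<lambda>k x. x [^]\<^bsub>G\<^esub> k)\<rparr>"

definition lin_independent ::
    "('r, 'k) ring_scheme \<Rightarrow> ('r, 'a, 'm) module_scheme \<Rightarrow> 'i set \<Rightarrow> ('i \<Rightarrow> 'a) \<Rightarrow> bool" where
  "lin_independent R M I b \<longleftrightarrow>
     (\<forall>A c. finite A \<and> A \<subseteq> I \<and> c \<in> A \<rightarrow> carrier R \<and>
        finsum M (\<lambda>i. c i \<odot>\<^bsub>M\<^esub> b i) A = \<zero>\<^bsub>M\<^esub> \<longrightarrow> (\<forall>i\<in>A. c i = \<zero>\<^bsub>R\<^esub>))"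

definition generates ::
    "('r, 'k) ring_scheme \<Rightarrow> ('r, 'a, 'm) module_scheme \<Rightarrow> 'i set \<Rightarrow> ('i \<Rightarrow> 'a) \<Rightarrow> bool" where
  "generates R M I b \<longleftrightarrow>
     (\<forall>x\<in>carrier M. \<exists>A c. finite A \<and> A \<subseteq> I \<and> c \<in> A \<rightarrow> carrier R \<and>
        x = finsum M (\<lambda>i. c i \<odot>\<^bsub>M\<^esub> b i) A)"

definition free_basis ::
    "('r, 'k) ring_scheme \<Rightarrow> ('r, 'a, 'm) module_scheme \<Rightarrow> 'i set \<Rightarrow> ('i \<Rightarrow> 'a) \<Rightarrow> bool" where
  "free_basis R M I b \<longleftrightarrow>
     b \<in> I \<rightarrow> carrier M \<and> lin_independent R M I b \<and> generates R M I b"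

lemma (in comm_group) abelian_group_int_module: "abelian_group (int_module G)"
  by (rule abelian_groupI) (auto simp: int_module_def m_ac intro: l_inv_ex)

lemma (in comm_group) module_int_module: "module \<Z> (int_module G)"
proof (rule moduleI[OF int_is_cring abelian_group_int_module])
qed (auto simp: int_module_def int_pow_mult int_pow_distrib int_pow_pow mult.commute)

lemma (in comm_group) normal_multiples: "multiples G n \<lhd> G"
proof -
  have "subgroup (multiples G n) G"
  proof
    show "inv x \<in> multiples G n" if "x \<in> multiples G n" for x
      using that unfolding multiples_def by (auto simp flip: nat_pow_inv)
    show "\<one> \<in> multiples G n"
      unfolding multiples_def by (rule image_eqI[of _ _ \<one>]) auto
  qed (auto simp: multiples_def simp flip: nat_pow_distrib)
  then show ?thesis
    by (rule subgroup_imp_normal)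
qed

lemma (in comm_group) module_residue_int_module:
  assumes n: "n > 1"
    and tors: "\<And>x. x \<in> carrier G \<Longrightarrow> x [^] (int n) = \<one>"
  shows "module (residue_ring (int n)) (int_module G)"
proof -
  interpret residues "int n" "residue_ring (int n)"
    using n by unfold_locales auto
  have red: "x [^] (k mod int n) = x [^] k" if "x \<in> carrier G" for x and k :: int
  proof -
    have "x [^] k = x [^] (int n * (k div int n) + k mod int n)"
      by simp
    also have "\<dots> = (x [^] int n) [^] (k div int n) \<otimes> x [^] (k mod int n)"
      using that by (simp only: int_pow_mult int_pow_pow)
    finally show ?thesis
      using that by (simp add: tors)
  qed
  show ?thesis
  proof (rule moduleI[OF cring abelian_group_int_module])
  qed (auto simp: int_module_def res_add_eq res_mult_eq res_one_eq red int_pow_mult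
      int_pow_distrib int_pow_pow mult.commute)
qed

lemma (in comm_group) module_Mod_multiples:
  assumes "n > 1"
  shows "module (residue_ring (int n)) (int_module (G Mod multiples G n))"
proof -
  interpret N: normal "multiples G n" G
    by (rule normal_multiples)
  interpret Q: comm_group "G Mod multiples G n"
    by (rule abelian_FactGroup[OF N.subgroup_axioms])
  show ?thesis
  proof (rule Q.module_residue_int_module[OF assms])
    fix X assume "X \<in> carrier (G Mod multiples G n)"
    then obtain x where x: "x \<in> carrier G" "X = multiples G n #> x"
      by (auto simp: FactGroup_def RCOSETS_def)
    have "multiples G n #> (x [^] n) = multiples G n"
      using x by (intro coset_join2 N.subgroup_axioms) (auto simp: multiples_def)
    then show "X [^]\<^bsub>G Mod multiples G n\<^esub> int n = \<one>\<^bsub>G Mod multiples G n\<^esub>"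
      using x by (simp add: N.FactGroup_pow int_pow_int)
  qed
qed

lemma free_basis_free_Abelian_group:
  "free_basis \<Z> (int_module (free_Abelian_group S)) S frag_of"
proof -
  let ?M = "int_module (free_Abelian_group S)"
  interpret F: comm_group "free_Abelian_group S"
    by (rule abelian_free_Abelian_group)
  interpret M: module \<Z> ?M
    by (rule F.module_int_module)
  have smult: "c \<odot>\<^bsub>?M\<^esub> frag_of i = frag_cmul c (frag_of i)" if "i \<in> S" for c i
    using that by (simp add: int_module_def)
  have fsum: "finsum ?M (\<lambda>i. c i \<odot>\<^bsub>?M\<^esub> frag_of i) A = (\<Sum>i\<in>A. frag_cmul (c i) (frag_of i))"
    if "finite A" "A \<subseteq> S" for c :: "'a \<Rightarrow> int" and A
    using that
  proof (induction A)
    case empty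
    have "\<zero>\<^bsub>?M\<^esub> = 0"
      by (simp add: int_module_def)
    then show ?case by simp
  next
    case (insert a A)
    have "(\<lambda>i. c i \<odot>\<^bsub>?M\<^esub> frag_of i) \<in> insert a A \<rightarrow> carrier ?M"
      using insert.prems by (intro Pi_I M.smult_closed) (auto simp: int_module_def)
    then have "finsum ?M (\<lambda>i. c i \<odot>\<^bsub>?M\<^esub> frag_of i) (insert a A) =
        c a \<odot>\<^bsub>?M\<^esub> frag_of a \<oplus>\<^bsub>?M\<^esub> finsum ?M (\<lambda>i. c i \<odot>\<^bsub>?M\<^esub> frag_of i) A"
      using insert.hyps by (intro M.finsum_insert) auto
    moreover have "x \<oplus>\<^bsub>?M\<^esub> y = x + y" for x y
      by (simp add: int_module_def)
    ultimately show ?case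
      using insert by (simp add: smult)
  qed
  have coeff: "Poly_Mapping.lookup (\<Sum>i\<in>A. frag_cmul (c i) (frag_of i)) a = c a"
    if "finite A" "a \<in> A" for c :: "'a \<Rightarrow> int" and A a
    using that by (simp add: Poly_Mapping.lookup_sum lookup_single when_def
        if_distrib[of "\<lambda>x. _ * x"] cong: if_cong)
  have "lin_independent \<Z> ?M S frag_of"
    unfolding lin_independent_def
  proof (intro allI impI ballI, elim conjE)
    fix A :: "'a set" and c :: "'a \<Rightarrow> int" and a
    assume "a \<in> A" "finite A" "A \<subseteq> S"
      and "finsum ?M (\<lambda>i. c i \<odot>\<^bsub>?M\<^esub> frag_of i) A = \<zero>\<^bsub>?M\<^esub>"
    then have "(\<Sum>i\<in>A. frag_cmul (c i) (frag_of i)) = 0"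
      by (simp add: fsum) (simp add: int_module_def)
    with coeff[OF \<open>finite A\<close> \<open>a \<in> A\<close>, of c] show "c a = \<zero>\<^bsub>\<Z>\<^esub>"
      by simp
  qed
  moreover have "generates \<Z> ?M S frag_of"
    unfolding generates_def
  proof
    fix x assume "x \<in> carrier ?M"
    then have x: "Poly_Mapping.keys x \<subseteq> S"
      by (simp add: int_module_def)
    show "\<exists>A c. finite A \<and> A \<subseteq> S \<and> c \<in> A \<rightarrow> carrier \<Z> \<and>
        x = finsum ?M (\<lambda>i. c i \<odot>\<^bsub>?M\<^esub> frag_of i) A"
    proof (intro exI conjI)
      show "x = finsum ?M (\<lambda>i. Poly_Mapping.lookup x i \<odot>\<^bsub>?M\<^esub> frag_of i) (Poly_Mapping.keys x)"
        using x frag_expansion[of x] by (simp add: fsum frag_extend_def)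
    qed (use x in auto)
  qed
  ultimately show ?thesis
    by (auto simp: free_basis_def int_module_def)
qed

end

theory Submission
  imports Defs
begin

text \<open>Call a subgroup of a free abelian group cofree if the quotient by it is free. Suppose that
  vectors \<open>y\<^sub>i \<equiv> u\<^sub>i b\<^sub>i\<close> have been chosen for some indices \<open>i\<close> and span a cofree subgroup. For a new
  index \<open>j\<close> the image of \<open>b\<^sub>j\<close> in the quotient has a coordinate prime to \<open>p\<close>; a suitable
  \<open>y\<^sub>j \<equiv> u\<^sub>j b\<^sub>j\<close> has that coordinate equal to \<open>1\<close>, which keeps the span cofree. Moreover, any given
  vector can be absorbed into the span by adding finitely many \<open>y\<^sub>j\<close>, so a countable coordinate
  subgroup whose reduction is spanned by countably many \<open>b\<^sub>j\<close> can be exhausted in \<open>\<omega>\<close> steps. As every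
  coordinate lies in such a subgroup, Zorn's lemma, applied to partial families that span a full
  coordinate subgroup, gives the theorem. The resulting \<open>y\<^sub>i\<close> are independent over the integers
  because they are independent modulo \<open>p\<close>.\<close>

section \<open>Integer combinations of generators and coordinate subgroups\<close>

interpretation frag: Modules.module frag_cmul
  by unfold_locales (simp_all add: frag_cmul_distrib frag_cmul_distrib2)

declare frag.scale_minus_left [simp del] \<comment> \<open>loops with \<open>minus_frag_cmul\<close>\<close>

text \<open>This is the carrier of \<open>free_Abelian_group T\<close>. All coordinate subgroups
  live in one type, so they can be compared and united directly.\<close>

abbreviation frags :: "'s set \<Rightarrow> ('s \<Rightarrow>\<^sub>0 int) set" where
  "frags T \<equiv> {x. Poly_Mapping.keys x \<subseteq> T}"

lemma subspace_frags: "frag.subspace (frags T)"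
proof (rule frag.subspaceI)
  show "x + y \<in> frags T" if "x \<in> frags T" "y \<in> frags T" for x y
    using that keys_add[of x y] by auto
qed auto

lemma frag_cmul_in_frags_iff: "k \<noteq> 0 \<Longrightarrow> frag_cmul k x \<in> frags T \<longleftrightarrow> x \<in> frags T"
  by (auto simp: subset_iff)

lemma frags_diff: "x \<in> frags T \<Longrightarrow> y \<in> frags T \<Longrightarrow> x - y \<in> frags T"
  by (rule frag.subspace_diff[OF subspace_frags])

lemma frags_add: "x \<in> frags T \<Longrightarrow> y \<in> frags T \<Longrightarrow> x + y \<in> frags T"
  by (rule frag.subspace_add[OF subspace_frags])

lemma frags_scale: "x \<in> frags T \<Longrightarrow> frag_cmul k x \<in> frags T"
  by (rule frag.subspace_scale[OF subspace_frags])

lemma span_frag_of: "frag.span (frag_of ` T) = frags T"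
proof (rule frag.span_subspace[OF _ _ subspace_frags])
  show "frags T \<subseteq> frag.span (frag_of ` T)"
  proof
    fix x assume x: "x \<in> frags T"
    have "frag_extend frag_of x \<in> frag.span (frag_of ` T)"
      unfolding frag_extend_def using x
      by (intro frag.span_sum frag.span_scale frag.span_base) auto
    then show "x \<in> frag.span (frag_of ` T)"
      by (simp flip: frag_expansion)
  qed
qed auto

text \<open>The bound on the keys keeps the divided vector in the same coordinate subgroup, so that
  it still has a preimage under a map onto that subgroup.\<close>

lemma dvd_imp_frag_cmul:
  assumes "\<And>s. d dvd Poly_Mapping.lookup x s"
  obtains z where "x = frag_cmul d z" "Poly_Mapping.keys z \<subseteq> Poly_Mapping.keys x"
proof -
  define z where
    "z = (\<Sum>s\<in>Poly_Mapping.keys x. frag_cmul (Poly_Mapping.lookup x s div d) (frag_of s))"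
  have "frag_cmul d z = (\<Sum>s\<in>Poly_Mapping.keys x. frag_cmul (Poly_Mapping.lookup x s) (frag_of s))"
    using assms by (simp add: z_def frag_cmul_sum)
  also have "\<dots> = x"
    using frag_expansion[of x] by (simp add: frag_extend_def)
  finally have "x = frag_cmul d z" by simp
  moreover have "z \<in> frags (Poly_Mapping.keys x)"
    unfolding z_def using keys_cmul
    by (intro frag.subspace_sum[OF subspace_frags]) (auto split: if_splits)
  ultimately show thesis using that by auto
qed

subsection \<open>Spans modulo an integer\<close>

text \<open>The preimage of the subgroup that \<open>X\<close> generates modulo \<open>d\<close>; no
  quotient has to be formed. For \<open>d = 0\<close> it is the ordinary span.\<close>

definition mod_span :: "int \<Rightarrow> ('s \<Rightarrow>\<^sub>0 int) set \<Rightarrow> ('s \<Rightarrow>\<^sub>0 int) set" where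
  "mod_span d X = frag.span (X \<union> range (frag_cmul d))"

lemma subspace_mod_span: "frag.subspace (mod_span d X)"
  by (simp add: mod_span_def)

lemmas mod_span_add = frag.subspace_add[OF subspace_mod_span]
  and mod_span_diff = frag.subspace_diff[OF subspace_mod_span]
  and mod_span_scale = frag.subspace_scale[OF subspace_mod_span]
  and mod_span_sum = frag.subspace_sum[OF subspace_mod_span]

lemma mod_span_base: "x \<in> X \<Longrightarrow> x \<in> mod_span d X"
  by (simp add: mod_span_def frag.span_base)

lemma mod_span_multiple: "frag_cmul d z \<in> mod_span d X"
  by (simp add: mod_span_def frag.span_base)

lemma span_subset_mod_span: "frag.span X \<subseteq> mod_span d X"
  by (simp add: mod_span_def frag.span_mono)

lemma mod_span_multiple_dvd: "d dvd k \<Longrightarrow> frag_cmul k z \<in> mod_span d X"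
  using mod_span_multiple by (metis dvdE frag_cmul_cmul)

lemma mod_span_minimal: "X \<subseteq> mod_span d Y \<Longrightarrow> mod_span d X \<subseteq> mod_span d Y"
  unfolding mod_span_def[of d X]
  by (rule frag.span_minimal) (auto simp: subspace_mod_span mod_span_multiple)

lemma mod_span_mono: "X \<subseteq> Y \<Longrightarrow> mod_span d X \<subseteq> mod_span d Y"
  by (rule mod_span_minimal) (auto intro: mod_span_base)

lemma mod_span_iff: "x \<in> mod_span d X \<longleftrightarrow> (\<exists>z. x - frag_cmul d z \<in> frag.span X)"
proof
  have "frag.subspace (range (frag_cmul d))"
    using module_hom.subspace_image[OF frag.module_hom_scale_self frag.subspace_UNIV] .
  then have multiples: "frag.span (range (frag_cmul d)) = range (frag_cmul d)"
    using frag.span_eq_iff by blast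
  assume "x \<in> mod_span d X"
  then obtain a z where "x = a + frag_cmul d z" "a \<in> frag.span X"
    unfolding mod_span_def frag.span_Un multiples by blast
  then show "\<exists>z. x - frag_cmul d z \<in> frag.span X"
    by (metis add_diff_cancel_right')
next
  assume "\<exists>z. x - frag_cmul d z \<in> frag.span X"
  then obtain z where "x - frag_cmul d z \<in> mod_span d X"
    using span_subset_mod_span by blast
  from mod_span_add[OF this mod_span_multiple[of d z]] show "x \<in> mod_span d X"
    by simp
qed

lemma mod_span_insert_iff:
  "x \<in> mod_span d (insert a X) \<longleftrightarrow> (\<exists>k. x - frag_cmul k a \<in> mod_span d X)"
  by (simp add: mod_span_def frag.span_insert)

text \<open>A Bezout relation for \<open>k\<close> and \<open>d\<close> writes \<open>x\<close> as a
  multiple of \<open>frag_cmul k x\<close> plus a multiple of \<open>d\<close>.\<close>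

lemma mod_span_cancel:
  assumes "coprime k d" "frag_cmul k x \<in> mod_span d X"
  shows "x \<in> mod_span d X"
proof -
  obtain r q where rq: "r * k + q * d = 1"
    using assms(1) by (metis coprime_iff_gcd_eq_1 bezout_int)
  have "x = frag_cmul (r * k + q * d) x"
    by (simp add: rq)
  also have "\<dots> = frag_cmul r (frag_cmul k x) + frag_cmul d (frag_cmul q x)"
    by (simp add: frag_cmul_distrib mult.commute)
  also have "\<dots> \<in> mod_span d X"
    by (intro mod_span_add mod_span_scale assms(2) mod_span_multiple)
  finally show ?thesis .
qed

text \<open>Steinitz exchange over the field Z/p: the coefficient of \<open>a\<close> is prime to
  \<open>p\<close>, since otherwise \<open>x\<close> would already lie in the smaller span, and so
  it can be cancelled.\<close>

lemma mod_span_exchange: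
  assumes "prime p" "x \<in> mod_span p (insert a X)" "x \<notin> mod_span p X"
  shows "a \<in> mod_span p (insert x X)"
proof -
  obtain k where k: "x - frag_cmul k a \<in> mod_span p X"
    using assms(2) by (auto simp: mod_span_insert_iff)
  have "\<not> p dvd k"
  proof
    assume "p dvd k"
    then have "frag_cmul k a \<in> mod_span p X"
      by (rule mod_span_multiple_dvd)
    from mod_span_add[OF k this] assms(3) show False by simp
  qed
  then have "coprime k p"
    using assms(1) by (metis coprime_commute prime_imp_coprime)
  moreover have "frag_cmul k a \<in> mod_span p (insert x X)"
  proof -
    have "x - (x - frag_cmul k a) \<in> mod_span p (insert x X)"
      using k mod_span_mono[of X "insert x X" p] by (blast intro: mod_span_diff mod_span_base)
    then show ?thesis by simp
  qed
  ultimately show ?thesis by (rule mod_span_cancel)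
qed

text \<open>Coefficients are attached to indices rather than to vectors, so \<open>b\<close> may
  repeat values on \<open>A\<close>.\<close>

lemma mod_span_image_finite:
  assumes "finite A" "x \<in> mod_span d (b ` A)"
  obtains c where "x - (\<Sum>i\<in>A. frag_cmul (c i) (b i)) \<in> range (frag_cmul d)"
proof -
  have "\<exists>c. x - (\<Sum>i\<in>A. frag_cmul (c i) (b i)) \<in> range (frag_cmul d)"
    using assms
  proof (induction A arbitrary: x)
    case empty
    then show ?case by (auto simp: mod_span_iff)
  next
    case (insert a A)
    obtain k where "x - frag_cmul k (b a) \<in> mod_span d (b ` A)"
      using insert.prems by (auto simp: mod_span_insert_iff)
    then obtain c where c: "x - frag_cmul k (b a) - (\<Sum>i\<in>A. frag_cmul (c i) (b i)) \<in> range (frag_cmul d)"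
      using insert.IH by blast
    have "(\<Sum>i\<in>A. frag_cmul ((c(a := k)) i) (b i)) = (\<Sum>i\<in>A. frag_cmul (c i) (b i))"
      using insert.hyps by (intro sum.cong) auto
    with c insert.hyps show ?case
      by (intro exI[of _ "c(a := k)"]) (simp add: algebra_simps)
  qed
  then show thesis using that by blast
qed

lemma mod_span_image_finite_subset:
  assumes "x \<in> mod_span d (b ` I)"
  obtains A where "finite A" "A \<subseteq> I" "x \<in> mod_span d (b ` A)"
proof -
  obtain z where "x - frag_cmul d z \<in> frag.span (b ` I)"
    using assms by (auto simp: mod_span_iff)
  then obtain X where "finite X" "X \<subseteq> b ` I" "x - frag_cmul d z \<in> frag.span X"
    unfolding frag.span_explicit by (auto intro!: frag.span_sum frag.span_scale frag.span_base)
  moreover from this obtain A where "finite A" "A \<subseteq> I" "X = b ` A"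
    by (meson finite_subset_image)
  ultimately show thesis
    using that[of A] by (auto simp: mod_span_iff)
qed

text \<open>For prime \<open>d\<close> this is linear independence over the field Z/d. It speaks of
  families, so it also forces distinct indices to have distinct vectors.\<close>

definition mod_independent :: "int \<Rightarrow> 'i set \<Rightarrow> ('i \<Rightarrow> 's \<Rightarrow>\<^sub>0 int) \<Rightarrow> bool" where
  "mod_independent d I b \<longleftrightarrow> (\<forall>i\<in>I. b i \<notin> mod_span d (b ` (I - {i})))"

lemma mod_independentD:
  assumes "mod_independent d I b" "i \<in> I" "J \<subseteq> I" "i \<notin> J"
  shows "b i \<notin> mod_span d (b ` J)"
proof -
  have "mod_span d (b ` J) \<subseteq> mod_span d (b ` (I - {i}))"
    using assms by (intro mod_span_mono) auto
  with assms show ?thesis by (auto simp: mod_independent_def)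
qed

lemma mod_independent_subset: "mod_independent d I b \<Longrightarrow> J \<subseteq> I \<Longrightarrow> mod_independent d J b"
  unfolding mod_independent_def[of d J]
  using mod_independentD[of d I b _ "J - {_}"] by blast

text \<open>If the new family were dependent at some \<open>j\<close> other than \<open>i\<close>,
  exchanging \<open>b j\<close> and \<open>e\<close> would put \<open>e\<close> into the span of the
  old vectors with index other than \<open>i\<close>.\<close>

lemma mod_independent_update:
  assumes p: "prime p" and ind: "mod_independent p I b" and "i \<in> I"
    and e: "e \<notin> mod_span p (b ` (I - {i}))"
  shows "mod_independent p I (b(i := e))"
  unfolding mod_independent_def
proof (intro ballI notI)
  fix j assume "j \<in> I" and j: "(b(i := e)) j \<in> mod_span p (b(i := e) ` (I - {j}))"
  show False
  proof (cases "j = i")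
    case True
    moreover have "b(i := e) ` (I - {i}) = b ` (I - {i})" by auto
    ultimately show False using j e by simp
  next
    case False
    then have "b(i := e) ` (I - {j}) = insert e (b ` (I - {i, j}))"
      using \<open>i \<in> I\<close> by (auto simp: image_iff)
    then have "b j \<in> mod_span p (insert e (b ` (I - {i, j})))"
      using j False by simp
    moreover have "b j \<notin> mod_span p (b ` (I - {i, j}))"
      using \<open>j \<in> I\<close> by (intro mod_independentD[OF ind]) auto
    ultimately have "e \<in> mod_span p (insert (b j) (b ` (I - {i, j})))"
      by (rule mod_span_exchange[OF p])
    also have "insert (b j) (b ` (I - {i, j})) = b ` (I - {i})"
      using \<open>j \<in> I\<close> False by auto
    finally show False using e by simp
  qed
qed

subsection \<open>Free quotients\<close>

text \<open>Freeness of the quotient is witnessed by a homomorphism onto a coordinate subgroup over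
  the same generator type, which gives the quotient explicit coordinates indexed by
  \<open>U\<close>.\<close>

definition cofree :: "'s set \<Rightarrow> ('s \<Rightarrow>\<^sub>0 int) set \<Rightarrow> bool" where
  "cofree T N \<longleftrightarrow> N \<subseteq> frags T \<and>
     (\<exists>U \<pi>. module_hom frag_cmul frag_cmul \<pi> \<and> \<pi> ` frags T = frags (U :: 's set) \<and>
        (\<forall>x\<in>frags T. \<pi> x = 0 \<longleftrightarrow> x \<in> N))"

lemma cofreeE:
  fixes T :: "'s set"
  assumes "cofree T N"
  obtains U :: "'s set" and \<pi> where "module_hom frag_cmul frag_cmul \<pi>" "\<pi> ` frags T = frags U"
    "\<And>x. x \<in> frags T \<Longrightarrow> \<pi> x = 0 \<longleftrightarrow> x \<in> N"
  using assms unfolding cofree_def by (elim conjE exE) simp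

lemma cofree_subset: "cofree T N \<Longrightarrow> N \<subseteq> frags T"
  by (simp add: cofree_def)

text \<open>Coordinate \<open>t\<close> of \<open>\<pi> y\<close> is 1, so \<open>\<pi> y\<close>
  can replace the basis vector at \<open>t\<close>; dividing by it deletes \<open>t\<close> from
  \<open>U\<close>.\<close>

lemma cofree_span_insert:
  fixes T U :: "'s set"
  assumes \<pi>: "module_hom frag_cmul frag_cmul \<pi>" "\<pi> ` frags T = frags U"
      "\<And>x. x \<in> frags T \<Longrightarrow> \<pi> x = 0 \<longleftrightarrow> x \<in> frag.span X"
    and X: "frag.span X \<subseteq> frags T"
    and y: "y \<in> frags T" "Poly_Mapping.lookup (\<pi> y) t = 1" 
  shows "cofree T (frag.span (insert y X))"
proof -
  interpret \<pi>: module_hom frag_cmul frag_cmul \<pi> by (rule \<pi>)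
  \<comment> \<open>\<open>\<rho>\<close> is \<open>\<pi>\<close> followed by the projection along
    \<open>\<pi> y\<close> that clears coordinate \<open>t\<close>.\<close>
  define \<rho> where "\<rho> x = \<pi> x - frag_cmul (Poly_Mapping.lookup (\<pi> x) t) (\<pi> y)" for x
  have "module_hom frag_cmul frag_cmul \<rho>"
    unfolding module_hom_iff
    by (intro conjI allI frag.module_axioms poly_mapping_eqI)
      (simp_all add: \<rho>_def \<pi>.add \<pi>.scale lookup_add lookup_minus algebra_simps)
  moreover have "\<rho> ` frags T = frags (U - {t})"
  proof (intro equalityI subsetI)
    fix w assume "w \<in> \<rho> ` frags T"
    then obtain x where x: "x \<in> frags T" "w = \<rho> x" by auto
    have "\<pi> x \<in> frags U" "\<pi> y \<in> frags U"
      using \<pi>(2) x y by blast+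
    then have "w \<in> frags U"
      unfolding x \<rho>_def by (intro frags_diff frags_scale)
    moreover have "Poly_Mapping.lookup w t = 0"
      using y by (simp add: x \<rho>_def lookup_minus)
    ultimately show "w \<in> frags (U - {t})"
      by (auto simp: in_keys_iff)
  next
    fix w assume w: "w \<in> frags (U - {t})"
    then have "w \<in> frags U" by auto
    then obtain x where x: "x \<in> frags T" "w = \<pi> x"
      using \<pi>(2) by (metis (no_types, lifting) imageE)
    have "Poly_Mapping.lookup w t = 0"
      using w by (auto simp: in_keys_iff subset_iff)
    then show "w \<in> \<rho> ` frags T"
      using x by (intro image_eqI[of _ _ x]) (auto simp: \<rho>_def)
  qed
  moreover have "\<forall>x\<in>frags T. \<rho> x = 0 \<longleftrightarrow> x \<in> frag.span (insert y X)"
  proof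
    fix x assume x: "x \<in> frags T"
    have "x - frag_cmul k y \<in> frag.span X \<longleftrightarrow> \<pi> x = frag_cmul k (\<pi> y)" for k
      using \<pi>(3)[OF frags_diff[OF x frags_scale[OF y(1)]]] by (simp add: \<pi>.diff \<pi>.scale)
    then have "x \<in> frag.span (insert y X) \<longleftrightarrow> (\<exists>k. \<pi> x = frag_cmul k (\<pi> y))"
      by (simp add: frag.span_insert)
    also have "\<dots> \<longleftrightarrow> \<pi> x = frag_cmul (Poly_Mapping.lookup (\<pi> x) t) (\<pi> y)"
      using y(2) by (metis lookup_frag_cmul mult.right_neutral)
    finally show "\<rho> x = 0 \<longleftrightarrow> x \<in> frag.span (insert y X)"
      by (simp add: \<rho>_def)
  qed
  moreover have "frag.span (insert y X) \<subseteq> frags T"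
    using X y(1) frag.span_superset[of X] by (intro frag.span_minimal subspace_frags) blast
  ultimately show ?thesis
    unfolding cofree_def by (intro conjI exI[of _ "U - {t}"] exI[of _ \<rho>])
qed

text \<open>The Euclidean algorithm: shearing two nonzero coordinates against each other lowers the sum
  of their absolute values.\<close>

lemma cofree_coordinate:
  fixes T :: "'s set"
  assumes "cofree T N" "x \<in> frags T"
  obtains U :: "'s set" and \<pi> s d where "module_hom frag_cmul frag_cmul \<pi>" "\<pi> ` frags T = frags U"
    "\<And>z. z \<in> frags T \<Longrightarrow> \<pi> z = 0 \<longleftrightarrow> z \<in> N"
    "\<pi> x = 0 \<or> s \<in> U \<and> \<pi> x = frag_cmul d (frag_of s)"
proof -
  define good where "good U \<pi> \<longleftrightarrow> module_hom frag_cmul frag_cmul \<pi> \<and> \<pi> ` frags T = frags U \<and>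
      (\<forall>z\<in>frags T. \<pi> z = 0 \<longleftrightarrow> z \<in> N)" for U :: "'s set" and \<pi> :: "('s \<Rightarrow>\<^sub>0 int) \<Rightarrow> 's \<Rightarrow>\<^sub>0 int"
  obtain U \<pi>0 where "good U \<pi>0"
    using assms(1) unfolding cofree_def good_def by blast
  define size where "size w = (\<Sum>s\<in>Poly_Mapping.keys w. nat \<bar>Poly_Mapping.lookup w s\<bar>)"
    for w :: "'s \<Rightarrow>\<^sub>0 int"
  \<comment> \<open>\<open>U\<close> stays fixed. Among all coordinate systems on the quotient, one
    with the smallest size of the image of \<open>x\<close> is taken.\<close>
  define \<pi> where "\<pi> = (ARG_MIN (\<lambda>\<pi>. size (\<pi> x)) \<pi>. good U \<pi>)"
  have good: "good U \<pi>" and min: "\<And>\<rho>. good U \<rho> \<Longrightarrow> size (\<pi> x) \<le> size (\<rho> x)"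
    using \<open>good U \<pi>0\<close> arg_min_natI arg_min_nat_le unfolding \<pi>_def by (metis (no_types, lifting))+
  interpret \<pi>: module_hom frag_cmul frag_cmul \<pi>
    using good by (simp add: good_def)
  have keysU: "Poly_Mapping.keys (\<pi> x) \<subseteq> U"
    using good assms(2) unfolding good_def by blast
  have "s = s'" if s: "s \<in> Poly_Mapping.keys (\<pi> x)" "s' \<in> Poly_Mapping.keys (\<pi> x)"
      "\<bar>Poly_Mapping.lookup (\<pi> x) s\<bar> \<le> \<bar>Poly_Mapping.lookup (\<pi> x) s'\<bar>" for s s'
  proof (rule ccontr)
    assume neq: "s \<noteq> s'"
    define a a' where "a = Poly_Mapping.lookup (\<pi> x) s" and "a' = Poly_Mapping.lookup (\<pi> x) s'"
    \<comment> \<open>With this choice \<open>a * k\<close> has the absolute value of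
      \<open>a\<close> and the sign of \<open>a'\<close>, so subtracting it shrinks
      \<open>a'\<close>.\<close>
    define k where "k = sgn a * sgn a'"
    have small: "\<bar>a' - a * k\<bar> < \<bar>a'\<bar>"
      using s unfolding k_def a_def[symmetric] a'_def[symmetric]
      by (auto simp: in_keys_iff sgn_if a_def a'_def)
    \<comment> \<open>\<open>\<sigma>\<close> shears coordinate \<open>s'\<close> by coordinate
      \<open>s\<close>, and \<open>\<tau>\<close> is its inverse: as \<open>s\<close> and
      \<open>s'\<close> differ, both leave coordinate \<open>s\<close> unchanged.\<close>
    define \<sigma> where "\<sigma> w = w - frag_cmul (Poly_Mapping.lookup w s * k) (frag_of s')"
      for w :: "'s \<Rightarrow>\<^sub>0 int"
    define \<tau> where "\<tau> w = w + frag_cmul (Poly_Mapping.lookup w s * k) (frag_of s')"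
      for w :: "'s \<Rightarrow>\<^sub>0 int"
    have \<sigma>\<tau>: "\<sigma> (\<tau> w) = w" "\<tau> (\<sigma> w) = w" for w
      using neq by (simp_all add: \<sigma>_def \<tau>_def lookup_add lookup_minus)
    have in_frags: "\<sigma> w \<in> frags U" "\<tau> w \<in> frags U" if "w \<in> frags U" for w
      unfolding \<sigma>_def \<tau>_def using that s(2) keysU
      by (intro frags_diff frags_add frags_scale; auto)+
    have "good U (\<sigma> \<circ> \<pi>)"
      unfolding good_def
    proof (intro conjI ballI)
      show "module_hom frag_cmul frag_cmul (\<sigma> \<circ> \<pi>)"
        unfolding module_hom_iff o_def
        by (intro conjI allI frag.module_axioms poly_mapping_eqI)
          (simp_all add: \<sigma>_def \<pi>.add \<pi>.scale lookup_add lookup_minus algebra_simps)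
      have "\<sigma> ` frags U = frags U"
        using in_frags \<sigma>\<tau> by (metis (no_types, lifting) image_eqI subsetI subset_antisym image_subsetI)
      then show "(\<sigma> \<circ> \<pi>) ` frags T = frags U"
        using good by (simp add: good_def flip: image_image image_comp)
      fix z assume "z \<in> frags T"
      have "\<sigma> w = 0 \<longleftrightarrow> w = 0" for w
        using \<sigma>\<tau>[of w] by (auto simp: \<sigma>_def \<tau>_def)
      then show "(\<sigma> \<circ> \<pi>) z = 0 \<longleftrightarrow> z \<in> N"
        using good \<open>z \<in> frags T\<close> by (auto simp: good_def)
    qed
    then have "size (\<pi> x) \<le> size (\<sigma> (\<pi> x))"
      using min by fastforce
    also have "size (\<sigma> (\<pi> x)) < size (\<pi> x)"
    proof -
      have look: "Poly_Mapping.lookup (\<sigma> (\<pi> x)) r =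
          (if r = s' then a' - a * k else Poly_Mapping.lookup (\<pi> x) r)" for r
        by (simp add: \<sigma>_def lookup_minus a_def a'_def)
      have "Poly_Mapping.keys (\<sigma> (\<pi> x)) \<subseteq> Poly_Mapping.keys (\<pi> x)"
        using s(2) by (auto simp: in_keys_iff look split: if_splits)
      then have "size (\<sigma> (\<pi> x)) =
          (\<Sum>r\<in>Poly_Mapping.keys (\<pi> x). nat \<bar>Poly_Mapping.lookup (\<sigma> (\<pi> x)) r\<bar>)"
        unfolding size_def by (intro sum.mono_neutral_left) (auto simp: in_keys_iff)
      also have "\<dots> < size (\<pi> x)"
        unfolding size_def using s(2) small
        by (intro sum_strict_mono_ex1 bexI[of _ s']) (auto simp: look a'_def)
      finally show ?thesis .
    qed
    finally show False by simp
  qed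
  \<comment> \<open>Two absolute values are always comparable, so the inequality above holds after
    swapping \<open>s\<close> and \<open>s'\<close> if necessary.\<close>
  then have uniq: "s = s'" if "s \<in> Poly_Mapping.keys (\<pi> x)" "s' \<in> Poly_Mapping.keys (\<pi> x)" for s s'
    using that by (metis linear)
  have "\<pi> x = 0 \<or> (\<exists>s d. s \<in> U \<and> \<pi> x = frag_cmul d (frag_of s))"
  proof (cases "Poly_Mapping.keys (\<pi> x) = {}")
    case False
    then obtain s where s: "Poly_Mapping.keys (\<pi> x) = {s}"
      using uniq by blast
    then have "\<pi> x = frag_cmul (Poly_Mapping.lookup (\<pi> x) s) (frag_of s)"
      using frag_expansion[of "\<pi> x"] by (simp add: frag_extend_def)
    then show ?thesis using s keysU by blast
  qed auto
  then obtain s d where "\<pi> x = 0 \<or> s \<in> U \<and> \<pi> x = frag_cmul d (frag_of s)"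
    by blast
  then show thesis
    using that[of \<pi> U s d] good unfolding good_def by blast
qed

subsection \<open>Partial lifts\<close>

text \<open>A partial lift is encoded as the graph of a partial function on the index set, so that chains
  of partial lifts have unions.\<close>

definition partial_lift ::
    "int \<Rightarrow> 'i set \<Rightarrow> ('i \<Rightarrow> 's \<Rightarrow>\<^sub>0 int) \<Rightarrow> ('i \<times> ('s \<Rightarrow>\<^sub>0 int)) set \<Rightarrow> bool" where
  "partial_lift d I b P \<longleftrightarrow> single_valued P \<and> Domain P \<subseteq> I \<and>
     (\<forall>(i, y)\<in>P. \<exists>u. coprime u d \<and> y - frag_cmul u (b i) \<in> range (frag_cmul d))"

lemma partial_lift_insert:
  assumes "partial_lift d I b P" "i \<in> I" "i \<notin> Domain P"
    and "coprime u d" "y - frag_cmul u (b i) \<in> range (frag_cmul d)"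
  shows "partial_lift d I b (insert (i, y) P)"
  using assms unfolding partial_lift_def single_valued_def by (auto 0 4)

lemma partial_lift_subset:
  "partial_lift d I b Q \<Longrightarrow> P \<subseteq> Q \<Longrightarrow> partial_lift d I b P"
  unfolding partial_lift_def by (blast intro: single_valued_subset)

text \<open>This permits replacing a vector \<open>b j\<close> temporarily while \<open>j\<close> is
  outside the domain, and shrinking or enlarging the index set.\<close>

lemma partial_lift_index_cong:
  assumes "partial_lift d I b P" "Domain P \<subseteq> J" "\<And>i. i \<in> Domain P \<Longrightarrow> b i = b' i"
  shows "partial_lift d J b' P"
  using assms unfolding partial_lift_def by (fastforce simp: DomainI)

lemma partial_lift_Union:
  assumes "subset.chain UNIV C" "\<And>P. P \<in> C \<Longrightarrow> partial_lift d I b P"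
  shows "partial_lift d I b (\<Union>C)"
proof -
  have "single_valued (\<Union>C)"
  proof (rule single_valuedI)
    fix i y z assume "(i, y) \<in> \<Union>C" "(i, z) \<in> \<Union>C"
    then obtain P where "P \<in> C" "(i, y) \<in> P" "(i, z) \<in> P"
      using assms(1) unfolding subset_chain_def by blast
    then show "y = z"
      using assms(2) unfolding partial_lift_def by (blast dest: single_valuedD)
  qed
  then show ?thesis
    using assms(2) unfolding partial_lift_def by fast
qed

text \<open>Each \<open>u\<close> is prime to \<open>d\<close>, hence invertible modulo its divisor
  \<open>e\<close>, so \<open>y\<close> and \<open>b i\<close> generate the same subgroup modulo
  \<open>e\<close>. Both \<open>e = p\<close> and \<open>e = d\<close> are used.\<close>

lemma partial_lift_mod_span:
  assumes P: "partial_lift d I b P" and "e dvd d"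
  shows "mod_span e (Range P) = mod_span e (b ` Domain P)"
proof (intro equalityI mod_span_minimal subsetI)
  have diff: "y - frag_cmul u (b i) \<in> mod_span e X"
    if "y - frag_cmul u (b i) \<in> range (frag_cmul d)" for y u i X
    using that mod_span_multiple_dvd[OF \<open>e dvd d\<close>] by fastforce
  {
    fix y assume "y \<in> Range P"
    then obtain i u where i: "(i, y) \<in> P" "y - frag_cmul u (b i) \<in> range (frag_cmul d)"
      using P unfolding partial_lift_def by fast
    then have "y - frag_cmul u (b i) + frag_cmul u (b i) \<in> mod_span e (b ` Domain P)"
      by (intro mod_span_add mod_span_scale diff mod_span_base) auto
    then show "y \<in> mod_span e (b ` Domain P)" by simp
  next
    fix x assume "x \<in> b ` Domain P"
    then obtain i y u where i: "x = b i" "(i, y) \<in> P" "coprime u d"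
        "y - frag_cmul u (b i) \<in> range (frag_cmul d)"
      using P unfolding partial_lift_def by fast
    have "y - (y - frag_cmul u (b i)) \<in> mod_span e (Range P)"
      using i by (blast intro: mod_span_diff mod_span_base diff)
    moreover have "coprime u e"
      using i(3) \<open>e dvd d\<close> by (metis coprime_divisors dvd_refl)
    ultimately show "x \<in> mod_span e (Range P)"
      using i(1) by (auto intro: mod_span_cancel)
  }
qed

text \<open>It allows a vector to be corrected into a lift of some \<open>b j\<close> while the span
  stays the same.\<close>

lemma span_insert_diff:
  assumes "q \<in> frag.span X"
  shows "frag.span (insert (e - q) X) = frag.span (insert e X)"
proof -
  have "x - frag_cmul k (e - q) \<in> frag.span X \<longleftrightarrow> x - frag_cmul k e \<in> frag.span X" for x k
    using frag.span_add_eq2[OF frag.span_scale[OF assms, of k], of "x - frag_cmul k e"]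
    by (simp add: frag.scale_right_diff_distrib algebra_simps)
  then show ?thesis by (simp add: frag.span_insert)
qed

lemma countable_rtrancl_Image:
  assumes "\<And>x. countable (r `` {x})"
  shows "countable (r\<^sup>* `` {a})"
proof -
  have "countable ((r ^^ n) `` {a})" for n
  proof (induction n)
    case (Suc n)
    have "(r ^^ Suc n) `` {a} = (\<Union>x\<in>(r ^^ n) `` {a}. r `` {x})"
      by auto
    then show ?case using Suc assms by simp
  qed simp
  moreover have "r\<^sup>* `` {a} = (\<Union>n. (r ^^ n) `` {a})"
    by (auto simp: rtrancl_power)
  ultimately show ?thesis by simp
qed

section \<open>Extending a partial lift by an index or by a vector\<close>

locale prime_power =
  fixes p m :: int and \<nu> :: nat
  assumes prime: "prime p" and pos: "\<nu> \<ge> 1" and m: "m = p ^ \<nu>"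
begin

lemma p_dvd_m: "p dvd m"
  using pos by (simp add: m)

lemma coprime_m: "\<not> p dvd u \<Longrightarrow> coprime u m"
  using prime by (simp add: m coprime_commute[of u] prime_imp_coprime)

text \<open>If all coordinates of the image of \<open>b i\<close> were divisible by
  \<open>p\<close>, then \<open>b i\<close> would lie in the span of the lifts modulo
  \<open>p\<close>. That is the span of the vectors already lifted, against independence.\<close>

lemma extend_index:
  fixes T :: "'s set"
  assumes ind: "mod_independent p I b" and P: "partial_lift m I b P"
    and cof: "cofree T (frag.span (Range P))" and i: "i \<in> I" "i \<notin> Domain P" "b i \<in> frags T"
  obtains y where "partial_lift m I b (insert (i, y) P)"
    "cofree T (frag.span (insert y (Range P)))"
proof -
  obtain U :: "'s set" and \<pi> where \<pi>: "module_hom frag_cmul frag_cmul \<pi>"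
      "\<pi> ` frags T = frags U" "\<And>x. x \<in> frags T \<Longrightarrow> \<pi> x = 0 \<longleftrightarrow> x \<in> frag.span (Range P)"
    using cof by (rule cofreeE) (rule that; simp)
  note PT = cofree_subset[OF cof]
  interpret \<pi>: module_hom frag_cmul frag_cmul \<pi> by (rule \<pi>)
  have "\<exists>t. \<not> p dvd Poly_Mapping.lookup (\<pi> (b i)) t"
  proof (rule ccontr)
    assume "\<not> ?thesis"
    then obtain z where z: "\<pi> (b i) = frag_cmul p z"
        "Poly_Mapping.keys z \<subseteq> Poly_Mapping.keys (\<pi> (b i))"
      using dvd_imp_frag_cmul by metis
    moreover have "\<pi> (b i) \<in> frags U"
      using \<pi>(2) i(3) by blast
    ultimately have "z \<in> \<pi> ` frags T"
      unfolding \<pi>(2) by auto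
    then obtain w where w: "z = \<pi> w" "w \<in> frags T" by blast
    have "b i - frag_cmul p w \<in> frag.span (Range P)"
      using \<pi>(3)[OF frags_diff[OF i(3) frags_scale[OF w(2), of p]]] z(1) w(1)
      by (simp add: \<pi>.diff \<pi>.scale)
    then have "b i \<in> mod_span p (b ` Domain P)"
      using partial_lift_mod_span[OF P p_dvd_m] mod_span_iff by blast
    moreover have "Domain P \<subseteq> I"
      using P by (simp add: partial_lift_def)
    ultimately show False
      using mod_independentD[OF ind] i by blast
  qed
  then obtain t where t: "\<not> p dvd Poly_Mapping.lookup (\<pi> (b i)) t" by blast
  \<comment> \<open>The Bezout coefficient \<open>u\<close> becomes the unit of the lift. The
    summand \<open>k * m\<close> times a preimage of \<open>frag_of t\<close>, which vanishes modulo
    \<open>m\<close>, completes the coordinate to 1.\<close>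
  then obtain u k where uk: "u * Poly_Mapping.lookup (\<pi> (b i)) t + k * m = 1"
    using coprime_m by (metis coprime_iff_gcd_eq_1 bezout_int)
  have "t \<in> Poly_Mapping.keys (\<pi> (b i))"
    using t by (auto simp: in_keys_iff)
  then have "frag_of t \<in> \<pi> ` frags T"
    using i(3) \<pi>(2) by auto
  then obtain z where z: "frag_of t = \<pi> z" "z \<in> frags T" by blast
  define y where "y = frag_cmul u (b i) + frag_cmul (k * m) z"
  have "y \<in> frags T"
    unfolding y_def using i z by (intro frags_add frags_scale)
  moreover have "Poly_Mapping.lookup (\<pi> y) t = 1"
    using uk by (simp add: y_def \<pi>.add \<pi>.scale lookup_add flip: z(1))
  ultimately have "cofree T (frag.span (insert y (Range P)))"
    by (intro cofree_span_insert[where t = t, OF \<pi>(1,2) _ PT]) (simp_all add: \<pi>(3))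
  moreover have "y - frag_cmul u (b i) \<in> range (frag_cmul m)"
    by (auto simp: y_def mult.commute[of k] intro!: range_eqI[of _ _ "frag_cmul k z"])
  moreover have "coprime u m"
    by (rule coprimeI) (metis uk dvd_add dvd_mult dvd_mult2)
  ultimately show thesis
    using that partial_lift_insert[OF P i(1,2)] by blast
qed

text \<open>It will be applied to a family in which one \<open>b j\<close> has been replaced by
  another vector.\<close>

lemma extend_finite:
  fixes T :: "'s set"
  assumes ind: "mod_independent p I b" and P: "partial_lift m I b P"
    and cof: "cofree T (frag.span (Range P))"
    and "finite A" "A \<subseteq> I" "b ` (A - Domain P) \<subseteq> frags T"
  shows "\<exists>Q. P \<subseteq> Q \<and> partial_lift m I b Q \<and> cofree T (frag.span (Range Q)) \<and>
           Domain Q = Domain P \<union> A"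
  using assms(4-)
proof (induction A)
  case empty
  show ?case using P cof by auto
next
  case (insert i A)
  have "b ` (A - Domain P) \<subseteq> frags T" "A \<subseteq> I"
    using insert.prems by blast+
  then obtain Q where Q: "P \<subseteq> Q" "partial_lift m I b Q" "cofree T (frag.span (Range Q))"
      "Domain Q = Domain P \<union> A"
    using insert.IH by blast
  show ?case
  proof (cases "i \<in> Domain Q")
    case True
    then show ?thesis using Q by (intro exI[of _ Q]) auto
  next
    case False
    then have "i \<in> I" "b i \<in> frags T"
      using insert.prems Q(4) by auto
    from extend_index[OF ind Q(2,3) this(1) False this(2)] obtain y where
      "partial_lift m I b (insert (i, y) Q)" "cofree T (frag.span (insert y (Range Q)))" .
    then show ?thesis
      using Q by (intro exI[of _ "insert (i, y) Q"]) auto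
  qed
qed

text \<open>The vector \<open>e\<close> first takes the place of some \<open>b i\<close>; only after all other basis vectors that
  occur in \<open>e\<close> modulo \<open>m\<close> have been lifted is it corrected, without changing the span, to a
  multiple of \<open>b i\<close> modulo \<open>m\<close>.\<close>

lemma extend_primitive:
  fixes T :: "'s set"
  assumes ind: "mod_independent p I b" and P: "partial_lift m I b P"
    and cof: "cofree T (frag.span (insert e (Range P)))"
    and e: "e \<notin> mod_span p (Range P)" "e \<in> mod_span m (b ` I)"
    and bT: "b ` (I - Domain P) \<subseteq> frags T"
  shows "\<exists>Q. P \<subseteq> Q \<and> partial_lift m I b Q \<and> cofree T (frag.span (Range Q)) \<and> e \<in> frag.span (Range Q)"
proof -
  obtain A where A: "finite A" "A \<subseteq> I" "e \<in> mod_span m (b ` A)"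
    using e(2) by (rule mod_span_image_finite_subset)
  obtain c where c: "e - (\<Sum>i\<in>A. frag_cmul (c i) (b i)) \<in> range (frag_cmul m)"
    using A(1,3) by (rule mod_span_image_finite)
  then have cX: "e - (\<Sum>i\<in>A. frag_cmul (c i) (b i)) \<in> mod_span d X" if "d dvd m" for d X
    using mod_span_multiple_dvd[OF that] by fastforce
  \<comment> \<open>Otherwise every term of the sum lies in the span of \<open>Range P\<close>
    modulo \<open>p\<close>, because its index is lifted or its coefficient is divisible by
    \<open>p\<close>; then so does \<open>e\<close>.\<close>
  have "\<exists>i\<in>A - Domain P. \<not> p dvd c i"
  proof (rule ccontr)
    assume contra: "\<not> ?thesis"
    have terms: "frag_cmul (c i) (b i) \<in> mod_span p (Range P)" if "i \<in> A" for i
      unfolding partial_lift_mod_span[OF P p_dvd_m] using contra that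
      by (cases "i \<in> Domain P") (auto intro: mod_span_base mod_span_scale mod_span_multiple_dvd)
    have "e - (\<Sum>i\<in>A. frag_cmul (c i) (b i)) + (\<Sum>i\<in>A. frag_cmul (c i) (b i))
        \<in> mod_span p (Range P)"
      by (intro mod_span_add cX p_dvd_m mod_span_sum terms)
    then show False
      using e(1) by simp
  qed
  then obtain j where j: "j \<in> A" "j \<notin> Domain P" "\<not> p dvd c j" by blast
  have sum_A: "(\<Sum>i\<in>A. frag_cmul (c i) (b i)) =
      frag_cmul (c j) (b j) + (\<Sum>i\<in>A - {j}. frag_cmul (c i) (b i))"
    using A j by (simp add: sum.remove)
  \<comment> \<open>Solving the expansion of \<open>e\<close> for the term at \<open>j\<close> and
    cancelling \<open>c j\<close> modulo \<open>p\<close> would make \<open>b j\<close> dependent on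
    the other vectors.\<close>
  have e_not: "e \<notin> mod_span p (b ` (I - {j}))"
  proof
    assume "e \<in> mod_span p (b ` (I - {j}))"
    moreover have "(\<Sum>i\<in>A - {j}. frag_cmul (c i) (b i)) \<in> mod_span p (b ` (I - {j}))"
      using A by (intro mod_span_sum mod_span_scale mod_span_base) auto
    ultimately have "e - (e - (\<Sum>i\<in>A. frag_cmul (c i) (b i)))
        - (\<Sum>i\<in>A - {j}. frag_cmul (c i) (b i)) \<in> mod_span p (b ` (I - {j}))"
      using cX[OF p_dvd_m] by (blast intro: mod_span_diff)
    then have "frag_cmul (c j) (b j) \<in> mod_span p (b ` (I - {j}))"
      by (simp add: sum_A)
    moreover have "coprime (c j) p"
      using j(3) prime by (metis coprime_commute prime_imp_coprime)
    ultimately have "b j \<in> mod_span p (b ` (I - {j}))"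
      by (blast intro: mod_span_cancel)
    then show False
      using ind j A by (auto simp: mod_independent_def)
  qed
  have jI: "j \<in> I" using j A by auto
  let ?b = "b(j := e)"
  have "partial_lift m I ?b P"
    using P by (rule partial_lift_index_cong) (use P j in \<open>auto simp: partial_lift_def\<close>)
  \<comment> \<open>For the modified family \<open>e\<close> is its own lift at \<open>j\<close>,
    with unit 1.\<close>
  then have P0: "partial_lift m I ?b (insert (j, e) P)"
    by (rule partial_lift_insert[of _ _ _ _ _ 1]) (use jI j in \<open>auto intro: range_eqI[of _ _ 0]\<close>)
  have bA: "?b ` (A - Domain (insert (j, e) P)) \<subseteq> frags T"
    using bT A by auto
  have cof0: "cofree T (frag.span (Range (insert (j, e) P)))"
    using cof by simp
  from extend_finite[OF mod_independent_update[OF prime ind jI e_not] P0 cof0 A(1,2) bA]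
  obtain Q where Q: "insert (j, e) P \<subseteq> Q" "partial_lift m I ?b Q" "cofree T (frag.span (Range Q))"
      "Domain Q = Domain (insert (j, e) P) \<union> A"
    by blast
  \<comment> \<open>\<open>R\<close> drops the provisional pair. It avoids \<open>j\<close>, so it
    is also a lift of the original family.\<close>
  define R where "R = Q - {(j, e)}"
  have "single_valued Q" "Domain Q \<subseteq> I"
    using Q(2) by (simp_all add: partial_lift_def)
  then have R: "Q = insert (j, e) R" "j \<notin> Domain R"
    using Q(1) by (auto simp: R_def single_valued_def)
  have "partial_lift m I ?b R"
    using Q(2) by (rule partial_lift_subset) (auto simp: R_def)
  then have R_lift: "partial_lift m I b R"
    by (rule partial_lift_index_cong) (use \<open>Domain Q \<subseteq> I\<close> R in auto)
  have "e - frag_cmul (c j) (b j) \<in> mod_span m (b ` Domain R)"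
  proof -
    have "A - {j} \<subseteq> Domain R"
      using Q(4) R by auto
    then have "(\<Sum>i\<in>A - {j}. frag_cmul (c i) (b i)) \<in> mod_span m (b ` Domain R)"
      by (intro mod_span_sum mod_span_scale mod_span_base) auto
    from mod_span_add[OF cX[OF dvd_refl] this] show ?thesis
      by (simp add: sum_A algebra_simps)
  qed
  then obtain z where z: "e - frag_cmul (c j) (b j) - frag_cmul m z \<in> frag.span (Range R)"
    unfolding partial_lift_mod_span[OF R_lift dvd_refl, symmetric] mod_span_iff by blast
  \<comment> \<open>\<open>q\<close> lies in the span of \<open>Range R\<close>, and
    \<open>e - q\<close> is \<open>c j\<close> times \<open>b j\<close> plus a multiple of
    \<open>m\<close>. So \<open>c j\<close> serves as the unit at \<open>j\<close>.\<close>
  define q where "q = e - frag_cmul (c j) (b j) - frag_cmul m z"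
  have "partial_lift m I b (insert (j, e - q) R)"
    by (rule partial_lift_insert[OF R_lift jI R(2) coprime_m[OF j(3)]])
      (simp add: q_def del: minus_frag_cmul)
  moreover have "frag.span (insert (e - q) (Range R)) = frag.span (Range Q)"
    using span_insert_diff[OF z[folded q_def]] by (simp add: R(1))
  moreover have "P \<subseteq> insert (j, e - q) R"
    using Q(1) j(2) R(1) by auto
  moreover have "e \<in> frag.span (Range Q)"
    using R(1) by (intro frag.span_base) auto
  ultimately show ?thesis
    using Q(3) by (intro exI[of _ "insert (j, e - q) R"]) simp
qed

text \<open>In suitable coordinates the image of \<open>x\<close> in the quotient is
  \<open>d\<close> times a basis vector. A preimage \<open>e\<close> of that basis vector is
  absorbed; \<open>x\<close> differs from \<open>d\<close> times \<open>e\<close> by an element of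
  the old span.\<close>

lemma extend_element:
  fixes T :: "'s set"
  assumes ind: "mod_independent p I b" and P: "partial_lift m I b P"
    and cof: "cofree T (frag.span (Range P))" and gen: "frags T \<subseteq> mod_span m (b ` I)"
    and bT: "b ` (I - Domain P) \<subseteq> frags T" and x: "x \<in> frags T"
  shows "\<exists>Q. P \<subseteq> Q \<and> partial_lift m I b Q \<and> cofree T (frag.span (Range Q)) \<and> x \<in> frag.span (Range Q)"
proof -
  obtain U :: "'s set" and \<pi> s d where \<pi>: "module_hom frag_cmul frag_cmul \<pi>"
      "\<pi> ` frags T = frags U" "\<And>z. z \<in> frags T \<Longrightarrow> \<pi> z = 0 \<longleftrightarrow> z \<in> frag.span (Range P)"
    and \<pi>x: "\<pi> x = 0 \<or> s \<in> U \<and> \<pi> x = frag_cmul d (frag_of s)"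
    by (rule cofree_coordinate[OF cof x]) (rule that; simp)
  interpret \<pi>: module_hom frag_cmul frag_cmul \<pi> by (rule \<pi>)
  show ?thesis
  proof (cases "\<pi> x = 0")
    case True
    then show ?thesis using P cof x \<pi>(3) by blast
  next
    case False
    with \<pi>x have s: "s \<in> U" "\<pi> x = frag_cmul d (frag_of s)" by auto
    then have "frag_of s \<in> \<pi> ` frags T"
      unfolding \<pi>(2) by auto
    then obtain e where e: "frag_of s = \<pi> e" "e \<in> frags T" by blast
    note PT = cofree_subset[OF cof]
    have cof': "cofree T (frag.span (insert e (Range P)))"
      by (rule cofree_span_insert[OF \<pi> PT e(2), of s]) (simp_all flip: e(1))
    \<comment> \<open>The image of \<open>e\<close> is the basis vector at \<open>s\<close>, which
      is not divisible by \<open>p\<close>.\<close>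
    have "e \<notin> mod_span p (Range P)"
    proof
      assume "e \<in> mod_span p (Range P)"
      then obtain z where z: "e - frag_cmul p z \<in> frag.span (Range P)"
        by (auto simp: mod_span_iff)
      then have diff: "e - frag_cmul p z \<in> frags T" using PT by blast
      from frags_diff[OF e(2) this] have "z \<in> frags T"
        using prime by (auto simp: frag_cmul_in_frags_iff)
      moreover have "\<pi> (e - frag_cmul p z) = 0"
        using \<pi>(3)[OF diff] z by blast
      ultimately have "frag_of s = frag_cmul p (\<pi> z)"
        by (simp add: \<pi>.diff \<pi>.scale e(1))
      then have "1 = p * Poly_Mapping.lookup (\<pi> z) s"
        by (metis lookup_frag_cmul lookup_single_eq)
      then show False
        using prime by (metis dvd_triv_left not_prime_unit)
    qed
    from extend_primitive[OF ind P cof' this _ bT] obtain Q where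
      Q: "P \<subseteq> Q" "partial_lift m I b Q" "cofree T (frag.span (Range Q))" "e \<in> frag.span (Range Q)"
      using gen e(2) by blast
    have "x - frag_cmul d e \<in> frag.span (Range P)"
      using \<pi>(3)[OF frags_diff[OF x frags_scale[OF e(2), of d]]] s(2) e(1)
      by (simp add: \<pi>.diff \<pi>.scale)
    also have "frag.span (Range P) \<subseteq> frag.span (Range Q)"
      using Q(1) by (intro frag.span_mono Range_mono)
    finally have "x - frag_cmul d e + frag_cmul d e \<in> frag.span (Range Q)"
      using Q(4) by (intro frag.span_add frag.span_scale)
    then show ?thesis using Q by auto
  qed
qed

section \<open>Countable exhaustion and Zorn's lemma\<close>

lemma cofree_frags: "U \<subseteq> T \<Longrightarrow> cofree T (frags U)"
  unfolding cofree_def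
proof (intro conjI exI ballI)
  assume U: "U \<subseteq> T"
  let ?\<pi> = "frag_extend (\<lambda>t. if t \<in> U then 0 else frag_of t)"
  have lookup: "Poly_Mapping.lookup (?\<pi> x) t = (if t \<in> U then 0 else Poly_Mapping.lookup x t)" for x t
  proof (induction x rule: frag_induction[OF subset_UNIV])
    case 1
    then show ?case by simp
  next
    case (2 x)
    then show ?case by simp
  next
    case (3 a b)
    then show ?case by (simp add: frag_extend_diff lookup_minus)
  qed
  show "module_hom frag_cmul frag_cmul ?\<pi>"
    by (simp add: module_hom_iff frag.module_axioms frag_extend_add frag_extend_cmul)
  show "?\<pi> ` frags T = frags (T - U)"
  proof (intro equalityI subsetI)
    fix x assume "x \<in> frags (T - U)"
    then show "x \<in> ?\<pi> ` frags T"
      by (intro image_eqI[of _ _ x] poly_mapping_eqI) (auto simp: lookup subset_iff in_keys_iff)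
  qed (auto simp: in_keys_iff lookup split: if_splits)
  fix x
  show "?\<pi> x = 0 \<longleftrightarrow> x \<in> frags U"
    by (auto simp: poly_mapping_eq_iff fun_eq_iff lookup in_keys_iff split: if_splits)
  show "frags U \<subseteq> frags T" using U by auto
qed

text \<open>The generators in \<open>T - U\<close> are absorbed one after another, with cofreeness
  kept at each finite stage. Cofreeness can be lost in an increasing union, but here the union spans
  \<open>frags T\<close> itself.\<close>

lemma extend_countable:
  assumes ind: "mod_independent p I b" and P: "partial_lift m I b P"
    and span_P: "frag.span (Range P) = frags U" and UT: "U \<subseteq> T" and count: "countable (T - U)"
    and gen: "frags T \<subseteq> mod_span m (b ` I)" and bT: "b ` (I - Domain P) \<subseteq> frags T"
  shows "\<exists>Q. P \<subseteq> Q \<and> partial_lift m I b Q \<and> frag.span (Range Q) = frags T"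
proof (cases "T = U")
  case True
  then show ?thesis using P span_P by blast
next
  case False
  \<comment> \<open>The enumeration is by all natural numbers, so the set must be nonempty, hence
    the case split; repetitions are harmless.\<close>
  define t where "t = from_nat_into (T - U)"
  have range_t: "range t = T - U"
    unfolding t_def using False UT count by (intro range_from_nat_into) auto
  define good where "good Q \<longleftrightarrow> P \<subseteq> Q \<and> partial_lift m I b Q \<and> cofree T (frag.span (Range Q))"
    for Q
  have "\<exists>f. \<forall>n. good (f n) \<and> f n \<subseteq> f (Suc n) \<and> frag_of (t n) \<in> frag.span (Range (f (Suc n)))"
  proof (rule dependent_nat_choice[of "\<lambda>_. good" "\<lambda>n Q R. Q \<subseteq> R \<and> frag_of (t n) \<in> frag.span (Range R)",
        simplified all_conj_distrib[symmetric]])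
    show "\<exists>Q. good Q"
      using P cofree_frags[OF UT] by (auto simp: good_def span_P)
    fix Q n assume Q: "good Q"
    then have Q': "P \<subseteq> Q" "partial_lift m I b Q" "cofree T (frag.span (Range Q))"
      by (simp_all add: good_def)
    have bQ: "b ` (I - Domain Q) \<subseteq> frags T"
      using bT Q'(1) by auto
    have tT: "frag_of (t n) \<in> frags T"
      using range_t by auto
    from extend_element[OF ind Q'(2,3) gen bQ tT] obtain R where
      "Q \<subseteq> R" "partial_lift m I b R" "cofree T (frag.span (Range R))"
      "frag_of (t n) \<in> frag.span (Range R)"
      by blast
    then show "\<exists>R. good R \<and> Q \<subseteq> R \<and> frag_of (t n) \<in> frag.span (Range R)"
      using Q'(1) by (intro exI[of _ R]) (simp add: good_def)
  qed
  then obtain f where f: "\<And>n. good (f n)" "\<And>n. f n \<subseteq> f (Suc n)"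
      "\<And>n. frag_of (t n) \<in> frag.span (Range (f (Suc n)))"
    by blast
  let ?Q = "\<Union>(range f)"
  have "subset.chain UNIV (range f)"
  proof -
    have mono: "f i \<subseteq> f j" if "i \<le> j" for i j
      using f(2) that by (rule lift_Suc_mono_le)
    have "f i \<subseteq> f j \<or> f j \<subseteq> f i" for i j
      using mono[of i j] mono[of j i] by linarith
    then show ?thesis by (simp add: subset_chain_def)
  qed
  then have "partial_lift m I b ?Q"
    by (rule partial_lift_Union) (use f(1) in \<open>auto simp: good_def\<close>)
  moreover have "frag.span (Range ?Q) = frags T"
  proof (rule frag.span_subspace[OF _ _ subspace_frags])
    have "Range (f n) \<subseteq> frags T" for n
      using f(1)[of n] frag.span_superset[of "Range (f n)"]
        cofree_subset[of T "frag.span (Range (f n))"] by (simp add: good_def)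
    then show "Range ?Q \<subseteq> frags T" by blast
    have "frag_of s \<in> frag.span (Range ?Q)" if "s \<in> T" for s
    proof (cases "s \<in> U")
      case True
      then have "frag_of s \<in> frag.span (Range P)"
        unfolding span_P by auto
      also have "\<dots> \<subseteq> frag.span (Range ?Q)"
        using f(1) by (intro frag.span_mono Range_mono) (auto simp: good_def)
      finally show ?thesis .
    next
      case False
      with that have "s \<in> range t"
        by (simp add: range_t)
      then obtain n where "s = t n" ..
      with f(3)[of n] have "frag_of s \<in> frag.span (Range (f (Suc n)))" by simp
      also have "\<dots> \<subseteq> frag.span (Range ?Q)"
        by (intro frag.span_mono Range_mono) auto
      finally show ?thesis .
    qed
    then show "frags T \<subseteq> frag.span (Range ?Q)"
      unfolding span_frag_of[symmetric] by (intro frag.span_minimal) auto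
  qed
  moreover have "P \<subseteq> ?Q"
    using f(1) by (auto simp: good_def)
  ultimately show ?thesis by blast
qed

text \<open>Spanning a full coordinate subgroup, unlike cofreeness, passes to unions of chains and
  implies cofreeness by \<open>cofree_frags\<close>. A maximal lift spanning a smaller
  \<open>frags T\<close> could be enlarged by countably many generators.\<close>

lemma exists_full_lift:
  assumes ind: "mod_independent p I b" and gen: "frags S \<subseteq> mod_span m (b ` I)"
    and bS: "b ` I \<subseteq> frags S"
  shows "\<exists>P. partial_lift m I b P \<and> frag.span (Range P) = frags S \<and> Domain P = I"
proof -
  define lifts where "lifts = {P. partial_lift m I b P \<and> (\<exists>T\<subseteq>S. frag.span (Range P) = frags T)}"
  have "\<exists>P\<in>lifts. \<forall>Q\<in>lifts. P \<subseteq> Q \<longrightarrow> Q = P"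
  proof (rule subset_Zorn')
    fix C assume C: "subset.chain lifts C"
    then have "subset.chain UNIV C" "C \<subseteq> lifts"
      by (auto simp: subset_chain_def)
    then have lift: "partial_lift m I b (\<Union>C)"
      by (intro partial_lift_Union) (auto simp: lifts_def)
    have "\<forall>P\<in>C. \<exists>T\<subseteq>S. frag.span (Range P) = frags T"
      using \<open>C \<subseteq> lifts\<close> unfolding lifts_def by blast
    then obtain T where T: "\<And>P. P \<in> C \<Longrightarrow> T P \<subseteq> S \<and> frag.span (Range P) = frags (T P)"
      by metis
    have "frag.span (Range (\<Union>C)) = frags (\<Union>(T ` C))"
    proof (rule frag.span_subspace[OF _ _ subspace_frags])
      have "Range P \<subseteq> frags (T P)" if "P \<in> C" for P
        using T[OF that] by (metis frag.span_superset)
      then show "Range (\<Union>C) \<subseteq> frags (\<Union>(T ` C))" by blast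
      have "frag_of s \<in> frag.span (Range (\<Union>C))" if "P \<in> C" "s \<in> T P" for P s
      proof -
        have "frag_of s \<in> frag.span (Range P)"
          using T[OF that(1)] that(2) by auto
        also have "\<dots> \<subseteq> frag.span (Range (\<Union>C))"
          using that by (intro frag.span_mono Range_mono) auto
        finally show ?thesis .
      qed
      then show "frags (\<Union>(T ` C)) \<subseteq> frag.span (Range (\<Union>C))"
        unfolding span_frag_of[symmetric] by (intro frag.span_minimal) auto
    qed
    moreover have "\<Union>(T ` C) \<subseteq> S"
      using T by blast
    ultimately show "\<Union>C \<in> lifts"
      using lift unfolding lifts_def by blast
  qed
  then obtain P where "P \<in> lifts" and max: "\<And>Q. Q \<in> lifts \<Longrightarrow> P \<subseteq> Q \<Longrightarrow> Q = P"
    by blast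
  then obtain T where P: "partial_lift m I b P" "T \<subseteq> S" "frag.span (Range P) = frags T"
    by (auto simp: lifts_def)
  have "T = S"
  proof (rule ccontr)
    assume "T \<noteq> S"
    then obtain a where a: "a \<in> S" "a \<notin> T" using P(2) by blast
    have "\<exists>A. finite A \<and> A \<subseteq> I \<and> frag_of t \<in> mod_span m (b ` A)" if "t \<in> S" for t
    proof -
      have "frag_of t \<in> mod_span m (b ` I)" using gen that by auto
      then show ?thesis by (rule mod_span_image_finite_subset) blast
    qed
    then obtain A where A: "\<And>t. t \<in> S \<Longrightarrow> finite (A t)" "\<And>t. t \<in> S \<Longrightarrow> A t \<subseteq> I"
        "\<And>t. t \<in> S \<Longrightarrow> frag_of t \<in> mod_span m (b ` A t)"
      by metis
    \<comment> \<open>\<open>r\<close> leads from \<open>t\<close> to the generators occurring in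
      the finitely many \<open>b i\<close> that express \<open>frag_of t\<close> modulo
      \<open>m\<close>. Closing \<open>a\<close> under \<open>r\<close> gives a countable
      \<open>R\<close> that contains the support of all these vectors.\<close>
    define r where "r = (SIGMA t:S. \<Union>i\<in>A t. Poly_Mapping.keys (b i))"
    define R where "R = r\<^sup>* `` {a}"
    have "countable R"
      unfolding R_def
    proof (rule countable_rtrancl_Image)
      fix t
      have "r `` {t} = (if t \<in> S then \<Union>i\<in>A t. Poly_Mapping.keys (b i) else {})"
        by (auto simp: r_def)
      then have "finite (r `` {t})"
        by (simp add: A(1))
      then show "countable (r `` {t})" by (rule countable_finite)
    qed
    have "R \<subseteq> S"
    proof
      fix t assume "t \<in> R"
      then have "(a, t) \<in> r\<^sup>*" by (simp add: R_def)
      then show "t \<in> S"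
        using A(2) bS by (induction rule: rtrancl_induct) (auto simp: a r_def)
    qed
    have closed: "b i \<in> frags R" if "t \<in> R" "i \<in> A t" for t i
      using that \<open>R \<subseteq> S\<close> unfolding R_def r_def by (auto intro: rtrancl_into_rtrancl)
    \<comment> \<open>With only these indices, all vectors still to be lifted lie in
      \<open>frags (T \<union> R)\<close>, and the family still generates that subgroup modulo
      \<open>m\<close>.\<close>
    let ?I = "Domain P \<union> \<Union>(A ` R)"
    have DP: "Domain P \<subseteq> I"
      using P(1) by (simp add: partial_lift_def)
    then have "?I \<subseteq> I"
      using A(2) \<open>R \<subseteq> S\<close> by blast
    have "\<exists>Q. P \<subseteq> Q \<and> partial_lift m ?I b Q \<and> frag.span (Range Q) = frags (T \<union> R)"
    proof (rule extend_countable)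
      show "mod_independent p ?I b"
        using ind \<open>?I \<subseteq> I\<close> by (rule mod_independent_subset)
      show "partial_lift m ?I b P"
        using P(1) by (rule partial_lift_index_cong) auto
      show "frag.span (Range P) = frags T" by (rule P)
      show "countable (T \<union> R - T)"
        using \<open>countable R\<close> by (rule countable_subset[rotated]) auto
      show "b ` (?I - Domain P) \<subseteq> frags (T \<union> R)"
        using closed by blast
      have "frag_of t \<in> mod_span m (b ` ?I)" if "t \<in> T \<union> R" for t
      proof (cases "t \<in> T")
        case True
        then have "frag_of t \<in> mod_span m (Range P)"
          using P(3) span_subset_mod_span by fastforce
        also have "\<dots> \<subseteq> mod_span m (b ` ?I)"
          unfolding partial_lift_mod_span[OF P(1) dvd_refl] by (intro mod_span_mono) auto
        finally show ?thesis .
      next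
        case False
        then have "t \<in> R" using that by blast
        then have "frag_of t \<in> mod_span m (b ` A t)"
          using A(3) \<open>R \<subseteq> S\<close> by blast
        also have "\<dots> \<subseteq> mod_span m (b ` ?I)"
          using \<open>t \<in> R\<close> by (intro mod_span_mono) auto
        finally show ?thesis .
      qed
      then show "frags (T \<union> R) \<subseteq> mod_span m (b ` ?I)"
        unfolding span_frag_of[symmetric]
        by (intro frag.span_minimal subspace_mod_span) auto
    qed auto
    then obtain Q where Q: "P \<subseteq> Q" "partial_lift m ?I b Q" "frag.span (Range Q) = frags (T \<union> R)"
      by blast
    have "Domain Q \<subseteq> I"
      using Q(2) \<open>?I \<subseteq> I\<close> unfolding partial_lift_def by (elim conjE) (rule order_trans)
    with Q(2) have "partial_lift m I b Q"
      by (rule partial_lift_index_cong) simp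
    moreover have "T \<union> R \<subseteq> S"
      using P(2) \<open>R \<subseteq> S\<close> by blast
    ultimately have "Q \<in> lifts"
      using Q(3) unfolding lifts_def by (intro CollectI conjI exI[of _ "T \<union> R"])
    from max[OF this Q(1)] Q(3) P(3) have "frags (T \<union> R) = frags T" by simp
    moreover have "frag_of a \<in> frags (T \<union> R)"
      by (auto simp: R_def)
    ultimately show False using a by auto
  qed
  \<comment> \<open>The lifts span \<open>frags S\<close>, so an unlifted \<open>b i\<close> would
    depend on the lifted vectors modulo \<open>p\<close>.\<close>
  moreover have "i \<in> Domain P" if "i \<in> I" for i
  proof (rule ccontr)
    assume "i \<notin> Domain P"
    moreover have "b i \<in> mod_span p (b ` Domain P)"
      using that bS P(3) \<open>T = S\<close> span_subset_mod_span
      unfolding partial_lift_mod_span[OF P(1) p_dvd_m, symmetric] by blast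
    ultimately show False
      using mod_independentD[OF ind that] P(1) by (auto simp: partial_lift_def)
  qed
  ultimately show ?thesis
    using P by (auto simp: partial_lift_def)
qed

end

subsection \<open>Independence over the integers\<close>

text \<open>A nontrivial integral relation with a coefficient of least absolute value could be divided
  by \<open>p\<close>.\<close>

lemma mod_independent_imp_independent:
  assumes p: "prime p" and ind: "mod_independent p I y" and A: "finite A" "A \<subseteq> I" "i \<in> A"
    and "(\<Sum>i\<in>A. frag_cmul (c i) (y i)) = 0"
  shows "c i = 0"
  using assms(6)
\<comment> \<open>The index \<open>i\<close> is fixed while the relation varies: dividing by
  \<open>p\<close> lowers the absolute value at \<open>i\<close> unless it is 0.\<close>
proof (induction "nat \<bar>c i\<bar>" arbitrary: c rule: less_induct)
  case less
  have "p dvd c j" if j: "j \<in> A" for j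
  proof (rule ccontr)
    assume "\<not> p dvd c j"
    have "frag_cmul (c j) (y j) + (\<Sum>i\<in>A - {j}. frag_cmul (c i) (y i)) = 0"
      using less.prems A(1) j by (simp add: sum.remove)
    then have "frag_cmul (c j) (y j) = 0 - (\<Sum>i\<in>A - {j}. frag_cmul (c i) (y i))"
      by (simp add: eq_neg_iff_add_eq_0)
    also have "\<dots> \<in> mod_span p (y ` (I - {j}))"
      using A by (intro mod_span_diff mod_span_sum mod_span_scale mod_span_base
          frag.subspace_0[OF subspace_mod_span]) auto
    finally have "y j \<in> mod_span p (y ` (I - {j}))"
      using \<open>\<not> p dvd c j\<close> p by (metis mod_span_cancel coprime_commute prime_imp_coprime)
    then show False
      using ind j A by (auto simp: mod_independent_def)
  qed
  then have c: "c j = p * (c j div p)" if "j \<in> A" for j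
    using that by simp
  have "frag_cmul p (\<Sum>j\<in>A. frag_cmul (c j div p) (y j)) = (\<Sum>j\<in>A. frag_cmul (c j) (y j))"
    unfolding frag_cmul_sum frag_cmul_cmul by (intro sum.cong refl) (simp flip: c)
  \<comment> \<open>Integer combinations of generators are torsion-free, so the factor
    \<open>p\<close> cancels.\<close>
  then have "(\<Sum>j\<in>A. frag_cmul (c j div p) (y j)) = 0"
    using less.prems p by auto
  note smaller = less.hyps[OF _ this]
  show "c i = 0"
  proof (rule ccontr)
    assume "c i \<noteq> 0"
    define q where "q = c i div p"
    have q: "c i = p * q"
      using c[OF A(3)] by (simp add: q_def)
    then have "q \<noteq> 0" using \<open>c i \<noteq> 0\<close> by auto
    have "1 * \<bar>q\<bar> < p * \<bar>q\<bar>"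
      using \<open>q \<noteq> 0\<close> prime_gt_1_int[OF p] by (intro mult_strict_right_mono) auto
    also have "\<dots> = \<bar>c i\<bar>"
      using prime_gt_1_int[OF p] unfolding q by (simp add: abs_mult)
    finally have "nat \<bar>c i div p\<bar> < nat \<bar>c i\<bar>"
      unfolding q_def[symmetric] by linarith
    from smaller[OF this] \<open>q \<noteq> 0\<close> show False
      unfolding q_def by contradiction
  qed
qed

text \<open>Away from \<open>i\<close> the \<open>y\<close> form a partial lift and span the same as
  the \<open>b\<close> modulo \<open>p\<close>, so a dependence of \<open>y i\<close> gives one of
  \<open>b i\<close>.\<close>

lemma (in prime_power) mod_independent_lift:
  assumes ind: "mod_independent p I b"
    and y: "\<And>i. i \<in> I \<Longrightarrow> coprime (u i) m \<and> y i - frag_cmul (u i) (b i) \<in> range (frag_cmul m)"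
  shows "mod_independent p I y"
  unfolding mod_independent_def
proof (intro ballI notI)
  fix i assume i: "i \<in> I" "y i \<in> mod_span p (y ` (I - {i}))"
  let ?P = "(\<lambda>j. (j, y j)) ` (I - {i})"
  have "partial_lift m I b ?P"
    using y by (auto simp: partial_lift_def single_valued_def)
  from partial_lift_mod_span[OF this p_dvd_m]
  have span: "mod_span p (y ` (I - {i})) = mod_span p (b ` (I - {i}))"
    by (simp add: Range_snd Domain_fst image_image)
  have "y i - frag_cmul (u i) (b i) \<in> mod_span p (b ` (I - {i}))"
    using y[OF i(1)] mod_span_multiple_dvd[OF p_dvd_m] by fastforce
  with i(2) have "y i - (y i - frag_cmul (u i) (b i)) \<in> mod_span p (b ` (I - {i}))"
    unfolding span by (rule mod_span_diff)
  then have "frag_cmul (u i) (b i) \<in> mod_span p (b ` (I - {i}))" by simp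
  moreover have "coprime (u i) p"
    using y[OF i(1)] p_dvd_m by (metis coprime_divisors dvd_refl)
  ultimately have "b i \<in> mod_span p (b ` (I - {i}))"
    by (blast intro: mod_span_cancel)
  then show False
    using ind i(1) by (simp add: mod_independent_def)
qed

text \<open>A dependence of \<open>b i\<close> modulo \<open>p\<close>, multiplied by
  \<open>p ^ (\<nu> - 1)\<close>, is a relation modulo \<open>m\<close>. Its coefficient at
  \<open>i\<close> is \<open>p ^ (\<nu> - 1)\<close>, which is not divisible by
  \<open>m\<close>.\<close>

lemma (in prime_power) residue_independent_imp_mod_independent:
  assumes ind: "\<And>A k. finite A \<Longrightarrow> A \<subseteq> I \<Longrightarrow> (\<And>i. i \<in> A \<Longrightarrow> 0 \<le> k i \<and> k i < m) \<Longrightarrow>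
      (\<Sum>i\<in>A. frag_cmul (k i) (b i)) \<in> range (frag_cmul m) \<Longrightarrow> \<forall>i\<in>A. k i = 0"
  shows "mod_independent p I b"
  unfolding mod_independent_def
proof (intro ballI notI)
  fix i assume i: "i \<in> I" "b i \<in> mod_span p (b ` (I - {i}))"
  obtain A where A: "finite A" "A \<subseteq> I - {i}" "b i \<in> mod_span p (b ` A)"
    using i(2) by (rule mod_span_image_finite_subset)
  obtain c z where z: "b i - (\<Sum>j\<in>A. frag_cmul (c j) (b j)) = frag_cmul p z"
    using A(1,3) by (rule mod_span_image_finite) blast
  define k where "k = (\<lambda>j. p ^ (\<nu> - 1) * (if j = i then 1 else - c j))"
  have m_eq: "m = p ^ (\<nu> - 1) * p"
    using pos by (simp add: m flip: power_Suc2)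
  have "m > 0"
    using prime_gt_0_int[OF prime] by (simp add: m)
  have "(\<Sum>j\<in>A. frag_cmul (k j) (b j)) = (\<Sum>j\<in>A. - frag_cmul (p ^ (\<nu> - 1)) (frag_cmul (c j) (b j)))"
    using A(2) by (intro sum.cong) (auto simp: k_def)
  then have "(\<Sum>j\<in>insert i A. frag_cmul (k j) (b j)) =
      frag_cmul (p ^ (\<nu> - 1)) (b i - (\<Sum>j\<in>A. frag_cmul (c j) (b j)))"
    using A(1,2) by (subst sum.insert)
      (auto simp: k_def sum_negf frag_cmul_sum frag.scale_right_diff_distrib
        simp del: minus_frag_cmul frag_cmul_cmul)
  also have "\<dots> = frag_cmul m z"
    by (simp add: z m_eq)
  finally have k_sum: "(\<Sum>j\<in>insert i A. frag_cmul (k j) (b j)) = frag_cmul m z" .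
  \<comment> \<open>The scalars of the residue ring are the representatives below \<open>m\<close>.
    Reducing the coefficients changes the sum by a multiple of \<open>m\<close>.\<close>
  have "frag_cmul (k j mod m) (b j) = frag_cmul (k j) (b j) - frag_cmul m (frag_cmul (k j div m) (b j))" for j
    by (simp add: minus_mult_div_eq_mod[symmetric] frag_cmul_diff_distrib)
  then have "(\<Sum>j\<in>insert i A. frag_cmul (k j mod m) (b j)) =
      frag_cmul m (z - (\<Sum>j\<in>insert i A. frag_cmul (k j div m) (b j)))"
    by (simp only: sum_subtractf k_sum frag.scale_right_diff_distrib frag_cmul_sum)
  then have "\<forall>j\<in>insert i A. k j mod m = 0"
    using A i(1) \<open>m > 0\<close> by (intro ind) auto
  then have "m dvd p ^ (\<nu> - 1)"
    by (simp add: k_def mod_eq_0_iff_dvd)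
  then have "\<nu> \<le> \<nu> - 1"
    unfolding m using prime by (metis dvd_power_iff_le not_prime_0 not_prime_unit dvd_power_iff)
  then show False using pos by simp
qed

subsection \<open>Homomorphisms from free abelian groups\<close>

text \<open>It translates sums in the module record into integer combinations of generators. It
  serves both the isomorphism onto \<open>G\<close> and its composite with the natural map to the
  quotient.\<close>

lemma (in comm_group) finsum_int_module:
  assumes h: "h \<in> hom (free_Abelian_group S) G" and "finite A"
    and x: "\<And>i. i \<in> A \<Longrightarrow> x i \<in> frags S" and y: "\<And>i. i \<in> A \<Longrightarrow> y i = h (x i)"
  shows "finsum (int_module G) (\<lambda>i. c i \<odot>\<^bsub>int_module G\<^esub> y i) A =
      h (\<Sum>i\<in>A. frag_cmul (c i) (x i))"
  using assms(2-)
proof (induction A)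
  interpret M: module \<Z> "int_module G"
    by (rule module_int_module)
  interpret h: group_hom "free_Abelian_group S" G h
    using h by (simp add: group_hom_def group_hom_axioms_def)
  case empty
  show ?case
    using h.hom_one by simp (simp add: int_module_def)
next
  interpret M: module \<Z> "int_module G"
    by (rule module_int_module)
  interpret h: group_hom "free_Abelian_group S" G h
    using h by (simp add: group_hom_def group_hom_axioms_def)
  case (insert a A)
  have closed: "h z \<in> carrier G" if "z \<in> frags S" for z
    using h.hom_closed[of z] that by simp
  have smult: "c i \<odot>\<^bsub>int_module G\<^esub> y i = h (frag_cmul (c i) (x i))" if "i \<in> insert a A" for i
    using h.hom_int_pow[of "x i" "c i"] insert.prems[OF that] by (simp add: int_module_def)
  have sum: "(\<Sum>i\<in>A. frag_cmul (c i) (x i)) \<in> frags S"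
    using insert.prems by (intro frag.subspace_sum[OF subspace_frags] frags_scale) auto
  have "finsum (int_module G) (\<lambda>i. c i \<odot>\<^bsub>int_module G\<^esub> y i) (insert a A) =
      c a \<odot>\<^bsub>int_module G\<^esub> y a \<oplus>\<^bsub>int_module G\<^esub>
        finsum (int_module G) (\<lambda>i. c i \<odot>\<^bsub>int_module G\<^esub> y i) A"
    using insert.hyps insert.prems closed
    by (intro M.finsum_insert) (auto simp: int_module_def)
  also have "\<dots> = h (frag_cmul (c a) (x a)) \<otimes> h (\<Sum>i\<in>A. frag_cmul (c i) (x i))"
    using smult[of a] insert.IH insert.prems by (simp add: int_module_def)
  also have "\<dots> = h (\<Sum>i\<in>insert a A. frag_cmul (c i) (x i))"
    using h.hom_mult[of "frag_cmul (c a) (x a)" "\<Sum>i\<in>A. frag_cmul (c i) (x i)"] insert sum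
      frags_scale[of "x a" S "c a"] by simp
  finally show ?case .
qed

section \<open>Transfer to an arbitrary free abelian group\<close>

theorem theorem1:
  fixes G :: "('a, 'm) monoid_scheme" (structure)
    and S :: "'s set"
    and p \<nu> :: nat
    and I :: "'i set"
    and b :: "'i \<Rightarrow> 'a"
  assumes "prime p" and "\<nu> \<ge> 1"
    and "comm_group G" and "G \<cong> free_Abelian_group S"
    and "b \<in> I \<rightarrow> carrier G"
    and "free_basis (residue_ring (int (p ^ \<nu>))) (int_module (G Mod multiples G (p ^ \<nu>))) I
           (\<lambda>\<alpha>. multiples G (p ^ \<nu>) #> b \<alpha>)"
  shows "\<exists>(u :: 'i \<Rightarrow> int) (y :: 'i \<Rightarrow> 'a).
           (\<forall>\<alpha>\<in>I. coprime (u \<alpha>) (int p)) \<and>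
           free_basis \<Z> (int_module G) I y \<and>
           (\<forall>\<alpha>\<in>I. multiples G (p ^ \<nu>) #> y \<alpha> =
              u \<alpha> \<odot>\<^bsub>int_module (G Mod multiples G (p ^ \<nu>))\<^esub> (multiples G (p ^ \<nu>) #> b \<alpha>))"
proof -
  interpret G: comm_group G by (rule assms)
  define n where "n = p ^ \<nu>"
  define M where "M = multiples G n"
  interpret M: normal M G
    unfolding M_def by (rule G.normal_multiples)
  interpret Q: comm_group "G Mod M"
    by (rule G.abelian_FactGroup[OF M.subgroup_axioms])
  interpret prime_power "int p" "int n" \<nu>
    using assms by unfold_locales (auto simp: n_def)
  let ?F = "free_Abelian_group S"
  obtain \<phi> where \<phi>: "\<phi> \<in> iso G ?F"
    using assms(4) by (auto simp: is_iso_def)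
  define g where "g = inv_into (carrier G) \<phi>"
  have g: "g \<in> iso ?F G"
    unfolding g_def using \<phi> by (rule G.iso_set_sym)
  interpret g: group_hom ?F G g
    using g by (simp add: group_hom_def group_hom_axioms_def iso_def)
  have bij: "bij_betw \<phi> (carrier G) (frags S)"
    using \<phi> by (simp add: iso_def free_Abelian_group_def)
  have g\<phi>: "g (\<phi> x) = x" if "x \<in> carrier G" for x
    using that bij by (simp add: g_def bij_betw_def)
  have \<phi>_frags: "\<phi> x \<in> frags S" if "x \<in> carrier G" for x
    using that bij by (auto simp: bij_betw_def)
  have g_closed: "g x \<in> carrier G" if "x \<in> frags S" for x
    using g.hom_closed[of x] that by simp
  have g_inj: "x = z" if "x \<in> frags S" "z \<in> frags S" "g x = g z" for x z
    using g that by (auto simp: iso_def bij_betw_def inj_on_def)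
  have g_one: "x = 0" if "x \<in> frags S" "g x = \<one>" for x
    using g_inj[OF that(1), of 0] that(2) g.hom_one by simp
  \<comment> \<open>The natural map to the quotient, read on \<open>frags S\<close>; its kernel
    there will be the multiples of \<open>n\<close>.\<close>
  define h where "h x = M #> g x" for x
  have h: "h \<in> hom ?F (G Mod M)"
    using hom_compose[OF g.homh M.r_coset_hom_Mod] by (simp add: h_def[abs_def] o_def)
  interpret h: group_hom ?F "G Mod M" h
    using h by (simp add: group_hom_def group_hom_axioms_def)
  have h_closed: "h x \<in> carrier (G Mod M)" if "x \<in> frags S" for x
    using h.hom_closed[of x] that by simp
  have h_one_iff: "h x = M \<longleftrightarrow> x \<in> range (frag_cmul n)" if x: "x \<in> frags S" for x
  proof -
    have "h x = M \<longleftrightarrow> g x \<in> M"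
      using G.coset_join1[OF _ g_closed[OF x] M.subgroup_axioms] 
        G.coset_join2[OF g_closed[OF x] M.subgroup_axioms] M.subset by (auto simp: h_def)
    also have "\<dots> \<longleftrightarrow> x \<in> range (frag_cmul n)"
    proof
      assume "g x \<in> M"
      then obtain a where a: "a \<in> carrier G" "g x = a [^] n"
        by (auto simp: M_def multiples_def)
      then have "g x = g (frag_cmul n (\<phi> a))"
        using g.hom_int_pow[of "\<phi> a" n] \<phi>_frags[OF a(1)] by (simp add: g\<phi> int_pow_int)
      then show "x \<in> range (frag_cmul n)"
        using g_inj[OF x] frags_scale[OF \<phi>_frags[OF a(1)]] by blast
    next
      assume "x \<in> range (frag_cmul n)"
      then obtain z where z: "x = frag_cmul n z" by blast
      \<comment> \<open>As \<open>n\<close> is nonzero, a multiple \<open>n z\<close> in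
        \<open>frags S\<close> comes from a \<open>z\<close> in \<open>frags S\<close>, so multiples
        taken in the whole type do no harm.\<close>
      have "int n \<noteq> 0"
        using assms(1) by (simp add: n_def prime_gt_0_nat)
      then have "z \<in> frags S"
        using x z frag_cmul_in_frags_iff by metis
      then have "g x = g z [^] n" "g z \<in> carrier G"
        using g.hom_int_pow[of z n] g_closed by (simp_all add: z int_pow_int)
      then show "g x \<in> M"
        by (auto simp: M_def multiples_def)
    qed
    finally show ?thesis .
  qed
  define b' where "b' i = \<phi> (b i)" for i
  have b: "b i \<in> carrier G" if "i \<in> I" for i
    using assms(5) that by auto
  have b': "b' i \<in> frags S" "M #> b i = h (b' i)" if "i \<in> I" for i
    using \<phi>_frags[OF b[OF that]] by (simp_all add: b'_def h_def g\<phi> b that)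
  have sum_frags: "(\<Sum>i\<in>A. frag_cmul (c i) (x i)) \<in> frags S"
    if "A \<subseteq> I" "\<And>i. i \<in> I \<Longrightarrow> x i \<in> frags S" for A c x
    using that by (intro frag.subspace_sum[OF subspace_frags] frags_scale) auto
  have fsum: "finsum (int_module (G Mod M)) (\<lambda>i. c i \<odot>\<^bsub>int_module (G Mod M)\<^esub> (M #> b i)) A =
      h (\<Sum>i\<in>A. frag_cmul (c i) (b' i))" if "finite A" "A \<subseteq> I" for A c
    by (rule Q.finsum_int_module[OF h]) (use b' that in blast)+
  have basis: "lin_independent (residue_ring (int n)) (int_module (G Mod M)) I (\<lambda>\<alpha>. M #> b \<alpha>)"
    "generates (residue_ring (int n)) (int_module (G Mod M)) I (\<lambda>\<alpha>. M #> b \<alpha>)"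
    using assms(6) by (simp_all add: free_basis_def M_def n_def)
  have zero: "\<zero>\<^bsub>int_module (G Mod M)\<^esub> = M"
    by (simp add: int_module_def)
  have ind: "mod_independent (int p) I b'"
  proof (rule residue_independent_imp_mod_independent)
    fix A k assume A: "finite A" "A \<subseteq> I" "\<And>i. i \<in> A \<Longrightarrow> 0 \<le> k i \<and> k i < int n"
      and "(\<Sum>i\<in>A. frag_cmul (k i) (b' i)) \<in> range (frag_cmul n)"
    then have "h (\<Sum>i\<in>A. frag_cmul (k i) (b' i)) = M"
      using h_one_iff[OF sum_frags[of A b' k]] b'(1) by blast
    then have relation: "finsum (int_module (G Mod M))
        (\<lambda>i. k i \<odot>\<^bsub>int_module (G Mod M)\<^esub> (M #> b i)) A = \<zero>\<^bsub>int_module (G Mod M)\<^esub>"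
      by (simp only: fsum[OF A(1,2)] zero)
    have k: "k \<in> A \<rightarrow> carrier (residue_ring (int n))"
      using A(3) by (fastforce simp: residue_ring_def)
    have "\<forall>i\<in>A. k i = \<zero>\<^bsub>residue_ring (int n)\<^esub>"
      by (rule basis(1)[unfolded lin_independent_def, THEN spec, THEN spec, THEN mp])
        (intro conjI A(1,2) k relation)
    then show "\<forall>i\<in>A. k i = 0"
      by (simp add: residue_ring_def)
  qed
  have gen: "frags S \<subseteq> mod_span (int n) (b' ` I)"
  proof
    fix x assume x: "x \<in> frags S"
    then have "h x \<in> carrier (int_module (G Mod M))"
      using h.hom_closed[of x] by (simp add: int_module_def)
    from basis(2)[unfolded generates_def, THEN bspec, OF this] obtain A c where A: "finite A" "A \<subseteq> I"
      and "h x = finsum (int_module (G Mod M)) (\<lambda>i. c i \<odot>\<^bsub>int_module (G Mod M)\<^esub> (M #> b i)) A"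
      by (elim exE conjE) (rule that)
    then have hx: "h x = h (\<Sum>i\<in>A. frag_cmul (c i) (b' i))"
      by (simp only: fsum)
    let ?s = "\<Sum>i\<in>A. frag_cmul (c i) (b' i)"
    have s: "?s \<in> frags S"
      using sum_frags A b'(1) by blast
    have d: "x - ?s \<in> frags S"
      using x s by (rule frags_diff)
    have "h (x - ?s) \<otimes>\<^bsub>G Mod M\<^esub> h ?s = h ?s"
      using h.hom_mult[of "x - ?s" ?s] s d hx by simp
    then have "h (x - ?s) = M"
      using Q.r_cancel_one[OF h_closed[OF s] h_closed[OF d]] by simp
    then have "x - ?s \<in> range (frag_cmul n)"
      using h_one_iff[OF d] by blast
    then have "x - ?s \<in> mod_span (int n) (b' ` I)"
      using mod_span_multiple by fastforce
    moreover have "?s \<in> mod_span (int n) (b' ` I)"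
      using A by (intro mod_span_sum mod_span_scale mod_span_base) auto
    ultimately have "x - ?s + ?s \<in> mod_span (int n) (b' ` I)"
      by (rule mod_span_add)
    then show "x \<in> mod_span (int n) (b' ` I)" by simp
  qed
  obtain P where P: "partial_lift (int n) I b' P" "frag.span (Range P) = frags S" "Domain P = I"
    using exists_full_lift[OF ind gen] b'(1) by blast
  then have "\<forall>i\<in>I. \<exists>y. (i, y) \<in> P" by blast
  then obtain y where y: "\<And>i. i \<in> I \<Longrightarrow> (i, y i) \<in> P" by metis
  have Range_P: "Range P = y ` I"
    using P(1,3) y unfolding partial_lift_def by (fastforce dest: single_valuedD)
  have "\<forall>i\<in>I. \<exists>u. coprime u (int n) \<and> y i - frag_cmul u (b' i) \<in> range (frag_cmul n)"
    using P(1) y unfolding partial_lift_def by fast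
  then obtain u where u: "\<And>i. i \<in> I \<Longrightarrow>
      coprime (u i) (int n) \<and> y i - frag_cmul (u i) (b' i) \<in> range (frag_cmul n)"
    by metis
  have y_frags: "y i \<in> frags S" if "i \<in> I" for i
    unfolding P(2)[symmetric] Range_P using that by (intro frag.span_base imageI)
  have y_ind: "mod_independent (int p) I y"
    by (rule mod_independent_lift[OF ind u])
  have fsum_y: "finsum (int_module G) (\<lambda>i. c i \<odot>\<^bsub>int_module G\<^esub> g (y i)) A =
      g (\<Sum>i\<in>A. frag_cmul (c i) (y i))" if "finite A" "A \<subseteq> I" for A c
    by (rule G.finsum_int_module[OF g.homh]) (use y_frags that in blast)+
  have "lin_independent \<Z> (int_module G) I (\<lambda>i. g (y i))"
    unfolding lin_independent_def
  proof (intro allI impI ballI, elim conjE)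
    fix A c i assume A: "finite A" "A \<subseteq> I" "i \<in> A"
      and "finsum (int_module G) (\<lambda>i. c i \<odot>\<^bsub>int_module G\<^esub> g (y i)) A = \<zero>\<^bsub>int_module G\<^esub>"
    then have "g (\<Sum>i\<in>A. frag_cmul (c i) (y i)) = \<one>"
      by (simp add: fsum_y) (simp add: int_module_def)
    then have "(\<Sum>i\<in>A. frag_cmul (c i) (y i)) = 0"
      using g_one sum_frags A y_frags by blast
    from mod_independent_imp_independent[OF prime y_ind A this] show "c i = \<zero>\<^bsub>\<Z>\<^esub>"
      by simp
  qed
  moreover have "generates \<Z> (int_module G) I (\<lambda>i. g (y i))"
    unfolding generates_def
  proof
    fix x assume "x \<in> carrier (int_module G)"
    then have x: "x \<in> carrier G" by (simp add: int_module_def)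
    then have "\<phi> x \<in> frag.span (y ` I)"
      unfolding Range_P[symmetric] P(2) by (rule \<phi>_frags)
    \<comment> \<open>With modulus 0 the finiteness lemmas for \<open>mod_span\<close> yield an
      exact integer combination.\<close>
    then have "\<phi> x \<in> mod_span 0 (y ` I)"
      using span_subset_mod_span by (rule rev_subsetD)
    then obtain A where A: "finite A" "A \<subseteq> I" "\<phi> x \<in> mod_span 0 (y ` A)"
      by (rule mod_span_image_finite_subset)
    obtain c where "\<phi> x - (\<Sum>i\<in>A. frag_cmul (c i) (y i)) \<in> range (frag_cmul 0)"
      using A(1,3) by (rule mod_span_image_finite)
    then have "\<phi> x = (\<Sum>i\<in>A. frag_cmul (c i) (y i))" by auto
    then have "x = finsum (int_module G) (\<lambda>i. c i \<odot>\<^bsub>int_module G\<^esub> g (y i)) A"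
      using g\<phi>[OF x] fsum_y[OF A(1,2)] by simp
    then show "\<exists>A c. finite A \<and> A \<subseteq> I \<and> c \<in> A \<rightarrow> carrier \<Z> \<and>
        x = finsum (int_module G) (\<lambda>i. c i \<odot>\<^bsub>int_module G\<^esub> g (y i)) A"
      using A(1,2) by (intro exI[of _ A] exI[of _ c]) auto
  qed
  moreover have "(\<lambda>i. g (y i)) \<in> I \<rightarrow> carrier (int_module G)"
    using g_closed y_frags by (auto simp: int_module_def)
  moreover have "M #> g (y i) = u i \<odot>\<^bsub>int_module (G Mod M)\<^esub> (M #> b i)" if i: "i \<in> I" for i
  proof -
    have ub: "frag_cmul (u i) (b' i) \<in> frags S"
      using b'(1)[OF i] by (rule frags_scale)
    have "h (y i) = h (y i - frag_cmul (u i) (b' i)) \<otimes>\<^bsub>G Mod M\<^esub> h (frag_cmul (u i) (b' i))"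
      using h.hom_mult[of "y i - frag_cmul (u i) (b' i)" "frag_cmul (u i) (b' i)"]
        ub frags_diff[OF y_frags[OF i] ub] by simp
    also have "h (y i - frag_cmul (u i) (b' i)) = M"
      using h_one_iff[OF frags_diff[OF y_frags[OF i] ub]] u[OF i] by blast
    also have "M \<otimes>\<^bsub>G Mod M\<^esub> h (frag_cmul (u i) (b' i)) = h (frag_cmul (u i) (b' i))"
      using Q.l_one[OF h_closed[OF ub]] by simp
    also have "\<dots> = h (b' i) [^]\<^bsub>G Mod M\<^esub> u i"
      using h.hom_int_pow[of "b' i" "u i"] b'(1)[OF i] by simp
    finally show ?thesis
      using b'(2)[OF i] by (simp add: h_def int_module_def)
  qed
  moreover have "coprime (u i) (int p)" if "i \<in> I" for i
    using u[OF that] p_dvd_m by (metis coprime_divisors dvd_refl)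
  ultimately show ?thesis
    unfolding free_basis_def M_def n_def by (intro exI[of _ u] exI[of _ "\<lambda>i. g (y i)"]) auto
qed

end
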